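(* Let $d\ge1$, $\beta>0$, and let $\theta=\theta(\beta,d)\in(0,1)$ be the distance exponent of the discrete $\beta$-LRP model. Let $\widehat a_n$ be the median of $\widehat d(\mathbf 0,n\mathbf 1)$ and $a_n$ the median of $d_{(1/n,\infty)}(\mathbf 0,\mathbf 1)$. Then the sequences $\{n^{1-\theta}a_n\}_{n\in\mathbb{N}}$, $\{n^{\theta-1}a_n^{-1}\}_{n\in\mathbb{N}}$, $\{n^{-\theta}\widehat a_n\}_{n\in\mathbb{N}}$ and $\{n^{\theta}\widehat a_n^{-1}\}_{n\in\mathbb{N}}$ are all uniformly bounded.
   Context: Discrete $\beta$-LRP model: the random graph on $\mathbb{Z}^d$ in which all edges $\langle \mathbf i,\mathbf j\rangle$ with $\|\mathbf i-\mathbf j\|_1=1$ are present, and, independently for different pairs, an edge $\langle \mathbf i,\mathbf j\rangle$ with $\|\mathbf i-\mathbf j\|_1>1$ is present with probability $1-\exp\{-\beta\int_{V_1(\mathbf i)}\int_{V_1(\mathbf j)}|\mathbf u-\mathbf v|^{-2d}d\mathbf u\,d\mathbf v\}$ (with $\exp\{-\infty\}=0$), where $V_1(\mathbf i)$ is the cube with center $\mathbf i$ and side length $1$ and $|\cdot|$ is the Euclidean norm. $\widehat d$ is its graph distance. $\mathbf 1=(1,\dots,1)$. The exponent $\theta$: by a known theorem (B\"aumler) there is $\theta=\theta(\beta,d)\in(0,1)$ such that $\widehat d(\mathbf 0,\mathbf u)\asymp_P|\mathbf u|^\theta$ over $\mathbf u\in\mathbb{Z}^d$, i.e. for every $\varepsilon>0$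 there are $c,C>0$ with $\mathbb{P}[c|\mathbf u|^\theta\le\widehat d(\mathbf 0,\mathbf u)\le C|\mathbf u|^\theta]\ge1-\varepsilon$ for all $\mathbf u\in\mathbb{Z}^d$. Continuous $\beta$-LRP model: $\mathcal E$ is the random set of (undirected) edges $\langle\mathbf x,\mathbf y\rangle$, $\mathbf x,\mathbf y\in\mathbb{R}^d$, given by the atoms of a Poisson point process where edges between $\mathbf x$ and $\mathbf y$ occur with intensity $\beta/|\mathbf x-\mathbf y|^{2d}$ with respect to Lebesgue measure on $\mathbb{R}^{2d}$ (the number of edges between disjoint Borel sets $A,B$ is Poisson with mean $\beta\int_A\int_B|\mathbf u-\mathbf v|^{-2d}d\mathbf u\,d\mathbf v$). The scope of $\langle\mathbf x,\mathbf y\rangle$ is $|\mathbf x-\mathbf y|$. For $\delta>0$, with $\mathcal E_{(\delta,\infty)}$ the set of edges with scope in $(\delta,\infty)$, $$d_{(\delta,\infty)}(\mathbf x,\mathbf y)=\min_{m\ge0}\Big\{|\mathbf x-\mathbf u_1|+\sum_{i=1}^{m-1}|\mathbf v_i-\mathbf u_{i+1}|+|\mathbf v_m-\mathbf y|:\{\langle\mathbf u_i,\mathbf v_i\rangle\}_{1\le i\le m}\subseteq\mathcal E_{(\delta,\infty)}\Big\},$$ where the case $m=0$ evaluates to $|\mathbf x-\mathbf y|$. *)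

theory Defs
  imports "HOL-Probability.Probability"
begin

section \<open>Connection intensities\<close>

text \<open>The dimension is \<^term>\<open>CARD('n)\<close>.  On the null set \<^term>\<open>x = y\<close> the intensity is the
  junk value 0, which affects no integral below.\<close>

definition lrp_intensity :: "real \<Rightarrow> real ^ 'n \<Rightarrow> real ^ 'n \<Rightarrow> ennreal" where
  "lrp_intensity \<beta> x y = ennreal (\<beta> / norm (x - y) ^ (2 * CARD('n)))"

definition lrp_mean :: "real \<Rightarrow> (real ^ 'n) set \<Rightarrow> (real ^ 'n) set \<Rightarrow> ennreal" where
  "lrp_mean \<beta> A B = (\<integral>\<^sup>+x\<in>A. (\<integral>\<^sup>+y\<in>B. lrp_intensity \<beta> x y \<partial>lborel) \<partial>lborel)"

section \<open>The discrete model\<close>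

definition lattice_point :: "int ^ 'n \<Rightarrow> real ^ 'n" where
  "lattice_point i = (\<chi> k. real_of_int (i $ k))"

definition norm1 :: "int ^ 'n \<Rightarrow> int" where
  "norm1 i = (\<Sum>k\<in>UNIV. \<bar>i $ k\<bar>)"

definition unit_cube :: "int ^ 'n \<Rightarrow> (real ^ 'n) set" where
  "unit_cube i = {x. \<forall>k. \<bar>x $ k - real_of_int (i $ k)\<bar> \<le> 1 / 2}"

text \<open>The mean is infinite when the cubes touch without being nearest neighbours
  (e.g. at a corner); the convention exp(-infinity) = 0 then makes the edge certain.\<close>

definition lrp_edge_prob :: "real \<Rightarrow> int ^ 'n \<Rightarrow> int ^ 'n \<Rightarrow> real" where
  "lrp_edge_prob \<beta> i j =
     (let J = lrp_mean \<beta> (unit_cube i) (unit_cube j)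
      in if J = \<infinity> then 1 else 1 - exp (- enn2real J))"

text \<open>A graph is given by its set of edges, an edge being an unordered pair \<^term>\<open>{i, j}\<close>.\<close>

locale discrete_lrp = prob_space M
  for M :: "'w measure" and \<beta> :: real and G :: "'w \<Rightarrow> (int ^ 'n) set set" +
  assumes edges: "\<omega> \<in> space M \<Longrightarrow> G \<omega> \<subseteq> {{i, j} | i j. i \<noteq> j}"
    and nearest_neighbours: "\<omega> \<in> space M \<Longrightarrow> norm1 (i - j) = 1 \<Longrightarrow> {i, j} \<in> G \<omega>"
    and long_edges_indep:
      "indep_events (\<lambda>e. {\<omega> \<in> space M. e \<in> G \<omega>}) {{i, j} | i j. norm1 (i - j) > 1}"
    and long_edges_prob:
      "norm1 (i - j) > 1 \<Longrightarrow> prob {\<omega> \<in> space M. {i, j} \<in> G \<omega>} = lrp_edge_prob \<beta> i j"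

text \<open>The value is arbitrary if the vertices are not connected; this does not occur in the model
  above, which contains all nearest-neighbour edges.\<close>

definition graph_dist :: "'v set set \<Rightarrow> 'v \<Rightarrow> 'v \<Rightarrow> nat" where
  "graph_dist E i j = (LEAST m. (i, j) \<in> {(x, y). {x, y} \<in> E} ^^ m)"

definition distance_exponent :: "'w measure \<Rightarrow> ('w \<Rightarrow> (int ^ 'n) set set) \<Rightarrow> real \<Rightarrow> bool" where
  "distance_exponent M G \<theta> \<longleftrightarrow>
     0 < \<theta> \<and> \<theta> < 1 \<and>
     (\<forall>\<epsilon>>0. \<exists>c>0. \<exists>C>0. \<forall>u.
        measure M {\<omega> \<in> space M.
            c * norm (lattice_point u) powr \<theta> \<le> real (graph_dist (G \<omega>) 0 u) \<and>
            real (graph_dist (G \<omega>) 0 u) \<le> C * norm (lattice_point u) powr \<theta>} \<ge> 1 - \<epsilon>)"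

section \<open>The continuous model\<close>

text \<open>Simple Poisson point processes, which are all that is needed for diffuse \<^term>\<open>\<mu>\<close>.  The finiteness
  clause is needed because \<^const>\<open>card\<close> is 0 on infinite sets.  The Poisson weights are written
  out because the library's Poisson distribution excludes the rate 0.\<close>

locale poisson_point_process = prob_space M
  for M :: "'w measure" and \<mu> :: "'a measure" and N :: "'w \<Rightarrow> 'a set" +
  assumes points: "\<omega> \<in> space M \<Longrightarrow> N \<omega> \<subseteq> space \<mu>"
    and count_events: "A \<in> sets \<mu> \<Longrightarrow> emeasure \<mu> A < \<infinity> \<Longrightarrow>
      {\<omega> \<in> space M. finite (N \<omega> \<inter> A) \<and> card (N \<omega> \<inter> A) = k} \<in> events"
    and count_poisson: "A \<in> sets \<mu> \<Longrightarrow> emeasure \<mu> A < \<infinity> \<Longrightarrow>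
      prob {\<omega> \<in> space M. finite (N \<omega> \<inter> A) \<and> card (N \<omega> \<inter> A) = k} =
        measure \<mu> A ^ k / fact k * exp (- measure \<mu> A)"
    and count_indep: "finite I \<Longrightarrow> disjoint_family_on B I \<Longrightarrow>
      (\<And>i. i \<in> I \<Longrightarrow> B i \<in> sets \<mu> \<and> emeasure \<mu> (B i) < \<infinity>) \<Longrightarrow>
      indep_vars (\<lambda>_. count_space UNIV) (\<lambda>i \<omega>. card (N \<omega> \<inter> B i)) (I :: nat set)"

text \<open>The mean measure on undirected edges \<^term>\<open>{x, y}\<close>.  Every undirected edge comes from two
  ordered pairs, hence the factor 1/2; it gives the mean number of edges between disjoint sets
  the value in \<open>emeasure_lrp_edge_measure\<close> below.\<close>

definition edge_algebra :: "(real ^ 'n) set measure" where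
  "edge_algebra = sigma UNIV {S. (\<lambda>(x, y). {x, y}) -` S \<in> sets borel}"

definition lrp_edge_measure :: "real \<Rightarrow> (real ^ 'n) set measure" where
  "lrp_edge_measure \<beta> =
     distr (density lborel (\<lambda>(x, y). lrp_intensity (\<beta> / 2) x y)) edge_algebra (\<lambda>(x, y). {x, y})"

definition continuous_lrp :: "'w measure \<Rightarrow> real \<Rightarrow> ('w \<Rightarrow> (real ^ 'n) set set) \<Rightarrow> bool" where
  "continuous_lrp M \<beta> \<E> \<longleftrightarrow> poisson_point_process M (lrp_edge_measure \<beta>) \<E>"

text \<open>The list holds the edges used, each oriented in the direction in which it is traversed.\<close>

fun path_cost :: "'a::real_normed_vector \<Rightarrow> ('a \<times> 'a) list \<Rightarrow> 'a \<Rightarrow> real" where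
  "path_cost x [] y = norm (x - y)"
| "path_cost x ((u, v) # es) y = norm (x - u) + path_cost v es y"

definition lrp_dist :: "real \<Rightarrow> (real ^ 'n) set set \<Rightarrow> real ^ 'n \<Rightarrow> real ^ 'n \<Rightarrow> real" where
  "lrp_dist \<delta> E x y =
     (INF es \<in> {es. \<forall>(u, v) \<in> set es. {u, v} \<in> E \<and> norm (u - v) > \<delta>}. path_cost x es y)"

section \<open>Medians\<close>

definition is_median :: "'w measure \<Rightarrow> ('w \<Rightarrow> real) \<Rightarrow> real \<Rightarrow> bool" where
  "is_median M X m \<longleftrightarrow>
     measure M {\<omega> \<in> space M. X \<omega> \<le> m} \<ge> 1 / 2 \<and> measure M {\<omega> \<in> space M. X \<omega> \<ge> m} \<ge> 1 / 2"

section \<open>Mean number of edges between disjoint sets\<close>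

lemma sets_edge_algebra:
  "sets (edge_algebra :: (real ^ 'n) set measure) = {S. (\<lambda>(x, y). {x, y}) -` S \<in> sets borel}"
  (is "_ = ?A")
proof -
  have "sigma_algebra UNIV ?A"
    unfolding sigma_algebra_iff2
  proof (intro conjI ballI allI impI)
    show "UNIV - S \<in> ?A" if "S \<in> ?A" for S
      using that borel_comp[of "(\<lambda>(x, y). {x, y}) -` S"] by (simp add: vimage_Compl Compl_eq_Diff_UNIV vimage_Diff)
    show "(\<Union>i. S i) \<in> ?A" if "range S \<subseteq> ?A" for S :: "nat \<Rightarrow> _"
      using that by (auto simp: vimage_UN)
  qed auto
  then show ?thesis
    unfolding edge_algebra_def by (simp add: sigma_algebra.sigma_sets_eq)
qed

lemma emeasure_lrp_edge_measure:
  fixes A B :: "(real ^ 'n) set"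
  assumes [measurable]: "A \<in> sets borel" "B \<in> sets borel" and disj: "A \<inter> B = {}" and "\<beta> > 0"
  shows "emeasure (lrp_edge_measure \<beta>) {{x, y} | x y. x \<in> A \<and> y \<in> B} = lrp_mean \<beta> A B"
proof -
  let ?f = "\<lambda>(x :: real ^ 'n, y). {x, y}"
  let ?g = "\<lambda>p :: (real ^ 'n) \<times> (real ^ 'n). lrp_intensity (\<beta> / 2) (fst p) (snd p)"
  let ?S = "{{x, y} | x y. x \<in> A \<and> y \<in> B}"
  have pre: "?f -` ?S = A \<times> B \<union> B \<times> A"
    by (auto simp: doubleton_eq_iff)
  have AB [measurable]: "A \<times> B \<in> sets borel" "B \<times> A \<in> sets borel"
    by (auto intro: borel_Times)
  have S: "?S \<in> sets edge_algebra"
    unfolding sets_edge_algebra using AB pre by auto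
  have f: "?f \<in> borel \<rightarrow>\<^sub>M edge_algebra"
    by (rule measurableI) (auto simp: sets_edge_algebra, simp add: edge_algebra_def)
  have g0: "(\<lambda>p :: (real ^ 'n) \<times> (real ^ 'n). lrp_intensity b (fst p) (snd p)) \<in> borel_measurable (borel \<Otimes>\<^sub>M borel)" for b
    unfolding lrp_intensity_def by measurable
  have g [measurable]: "(\<lambda>p :: (real ^ 'n) \<times> (real ^ 'n). lrp_intensity b (fst p) (snd p)) \<in> borel_measurable borel" for b
    using g0[of b] by (simp only: borel_prod)
  have g2 [measurable]: "(\<lambda>p :: (real ^ 'n) \<times> (real ^ 'n). lrp_intensity b (fst p) (snd p)) \<in> borel_measurable (lborel \<Otimes>\<^sub>M lborel)" for b
    using g0[of b] by (simp add: measurable_cong_sets[OF sets_pair_measure_cong[OF sets_lborel sets_lborel] refl])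
  have half: "2 * lrp_intensity (\<beta> / 2) x y = lrp_intensity \<beta> x y" for x y :: "real ^ 'n"
    using \<open>\<beta> > 0\<close> unfolding lrp_intensity_def
    by (simp flip: ennreal_numeral add: ennreal_mult[symmetric])
  have rect: "(\<integral>\<^sup>+p\<in>C \<times> D. lrp_intensity b (fst p) (snd p) \<partial>lborel) = (\<integral>\<^sup>+x\<in>C. (\<integral>\<^sup>+y\<in>D. lrp_intensity b x y \<partial>lborel) \<partial>lborel)"
    if [measurable]: "C \<in> sets borel" "D \<in> sets borel" for b and C D :: "(real ^ 'n) set"
  proof -
    have "(\<integral>\<^sup>+p\<in>C \<times> D. lrp_intensity b (fst p) (snd p) \<partial>lborel)
        = (\<integral>\<^sup>+p. lrp_intensity b (fst p) (snd p) * indicator (C \<times> D) p \<partial>(lborel \<Otimes>\<^sub>M lborel))"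
      by (simp add: lborel_prod)
    also have "\<dots> = (\<integral>\<^sup>+x. \<integral>\<^sup>+y. lrp_intensity b x y * indicator (C \<times> D) (x, y) \<partial>lborel \<partial>lborel)"
      by (subst lborel.nn_integral_fst[symmetric]) simp_all
    also have "\<dots> = (\<integral>\<^sup>+x\<in>C. (\<integral>\<^sup>+y\<in>D. lrp_intensity b x y \<partial>lborel) \<partial>lborel)"
      by (intro nn_integral_cong) (auto simp: indicator_times split: split_indicator)
    finally show ?thesis .
  qed
  have swap: "(\<integral>\<^sup>+p\<in>B \<times> A. ?g p \<partial>lborel) = (\<integral>\<^sup>+p\<in>A \<times> B. ?g p \<partial>lborel)"
  proof -
    have "(\<integral>\<^sup>+p\<in>B \<times> A. ?g p \<partial>lborel)
        = (\<integral>\<^sup>+p. ?g p * indicator (B \<times> A) p \<partial>(lborel \<Otimes>\<^sub>M lborel))"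
      by (simp add: lborel_prod)
    also have "\<dots> = (\<integral>\<^sup>+y. \<integral>\<^sup>+x. lrp_intensity (\<beta> / 2) x y * indicator (B \<times> A) (x, y) \<partial>lborel \<partial>lborel)"
      by (subst lborel_pair.nn_integral_snd[symmetric]) (simp_all add: split_beta)
    also have "\<dots> = (\<integral>\<^sup>+y\<in>A. (\<integral>\<^sup>+x\<in>B. lrp_intensity (\<beta>/2) y x \<partial>lborel) \<partial>lborel)"
      by (intro nn_integral_cong)
         (auto simp: indicator_times lrp_intensity_def norm_minus_commute split: split_indicator)
    finally show ?thesis by (simp add: rect split_beta)
  qed
  have "emeasure (lrp_edge_measure \<beta>) ?S = emeasure (density lborel ?g) (A \<times> B \<union> B \<times> A)"
    unfolding lrp_edge_measure_def case_prod_beta'[of "lrp_intensity (\<beta> / 2)"]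
    using S f by (subst emeasure_distr)
      (simp, simp, simp only: pre space_density space_lborel space_borel Int_UNIV_right)
  also have "\<dots> = emeasure (density lborel ?g) (A \<times> B) + emeasure (density lborel ?g) (B \<times> A)"
    using disj by (intro plus_emeasure[symmetric]) auto
  also have "\<dots> = 2 * (\<integral>\<^sup>+p\<in>A \<times> B. ?g p \<partial>lborel)"
    by (simp add: emeasure_density swap mult_2)
  also have "\<dots> = (\<integral>\<^sup>+p\<in>A \<times> B. 2 * ?g p \<partial>lborel)"
    by (subst nn_integral_cmult[symmetric]) (auto simp: mult.assoc)
  also have "\<dots> = lrp_mean \<beta> A B"
    by (simp add: half split_beta rect lrp_mean_def)
  finally show ?thesis .
qed

end

theory Submission
  imports Defs
begin

text \<open>
The discrete model sits inside the continuous one. Cut space into cubes of side \<open>1 / n\<close> centred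
at the points of the rescaled lattice, and join two of them if they are lattice neighbours or if some edge of
\<open>\<E>\<close> runs between them. The intensity is scale invariant and Poisson counts on disjoint sets
are independent, so this coarse graph is again a discrete \<open>\<beta>\<close>-LRP model
(\<open>discrete_lrp_coarse_graph\<close>). The axioms of that model determine the law of its distances
(\<open>measure_graph_dist_eq\<close>), so its distance \<open>D\<close> from \<open>0\<close> to
\<open>n 1\<close> satisfies \<open>c n ^ \<theta> \<le> D \<le> C n ^ \<theta>\<close> with probability at
least \<open>3 / 4\<close>, with constants from the given discrete model that do not depend on
\<open>n\<close>. For the medians \<open>a_hat\<close> this suffices. For the medians \<open>a\<close> it
remains to compare the continuous distance with \<open>D / n\<close>.

Upper bound. A path in the coarse graph can be followed in space by walking inside each cube from the end of
one edge to the beginning of the next, at cost at most \<open>d / n\<close> per step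
(\<open>lrp_dist_le_graph_dist\<close>).

Lower bound. A continuous path of cost \<open>L\<close> with \<open>m\<close> edges gives a walk in the coarse
graph, and \<open>D \<le> d n L + d (m + 1) + m\<close> (\<open>graph_walk_of_continuous_path\<close>). The
difficulty is that a cheap path might use a large number of edges joined by very short walks. A first moment
bound excludes this: there is \<open>s > 0\<close>, depending only on \<open>\<beta>\<close> and
\<open>d\<close>, such that with probability at least \<open>6 / 7\<close> every path from \<open>0\<close>
with \<open>m \<ge> 1\<close> distinct edges of scope greater than \<open>1 / n\<close> costs more than
\<open>s m / n\<close> (\<open>edges_cost_length\<close>). The bound is a count of paths on cells of mesh
\<open>s / n\<close>. The mean number of such edges that start in one cell is of order \<open>s ^ d\<close>,
while the number of ways to walk from the end of one edge to the beginning of the next contributes, for a path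
of cost at most \<open>s m / n\<close>, only a factor exponential in \<open>m\<close> that does not depend on
\<open>s\<close>. Since repeated edges can be cut out of any path (\<open>distinct_edges\<close>),
\<open>m\<close> is at most \<open>n L / s\<close>, and \<open>D\<close> is bounded by a multiple of
\<open>n L\<close>.

Finally \<open>1 / 2 + 3 / 4 - 1 / 7 > 1\<close>, so some realisation has a continuous distance not exceeding
the median and satisfies all of these bounds; similarly for the other half of the definition of a median.
\<close>

section \<open>Cells and their means\<close>

text \<open>The cells of mesh \<open>h\<close> are half-open, so that they partition space and every edge of the
continuous model lies over exactly one pair of cells. They differ from the closed cubes of the discrete model
by a null set only.\<close>

definition cell :: "real \<Rightarrow> real ^ 'n \<Rightarrow> int ^ 'n" where
  "cell h x = (\<chi> k. \<lfloor>x $ k / h + 1 / 2\<rfloor>)"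

abbreviation cube :: "real \<Rightarrow> int ^ 'n \<Rightarrow> (real ^ 'n) set" where
  "cube h i \<equiv> cell h -` {i}"

lemma cell_diff_le:
  assumes "h > 0"
  shows "real_of_int \<bar>cell h x $ k - cell h y $ k\<bar> \<le> \<bar>x $ k - y $ k\<bar> / h + 1"
proof -
  have "\<bar>x $ k - y $ k\<bar> / h = \<bar>x $ k / h - y $ k / h\<bar>"
    using assms by (simp add: diff_divide_distrib[symmetric])
  then show ?thesis
    unfolding cell_def by simp linarith
qed

lemma norm1_cell_diff_le:
  fixes x y :: "real ^ 'n"
  assumes "h > 0"
  shows "real_of_int (norm1 (cell h x - cell h y)) \<le> real CARD('n) * (norm (x - y) / h + 1)"
proof -
  have "real_of_int (norm1 (cell h x - cell h y)) = (\<Sum>k\<in>UNIV. real_of_int \<bar>cell h x $ k - cell h y $ k\<bar>)"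
    by (simp add: norm1_def)
  also have "\<dots> \<le> (\<Sum>k\<in>(UNIV :: 'n set). norm (x - y) / h + 1)"
  proof (intro sum_mono)
    fix k :: 'n
    have "\<bar>x $ k - y $ k\<bar> \<le> norm (x - y)"
      using component_le_norm_cart[of "x - y" k] by simp
    then have "\<bar>x $ k - y $ k\<bar> / h \<le> norm (x - y) / h"
      using assms by (simp add: divide_right_mono)
    then show "real_of_int \<bar>cell h x $ k - cell h y $ k\<bar> \<le> norm (x - y) / h + 1"
      using cell_diff_le[OF assms, of x k y] by linarith
  qed
  finally show ?thesis by simp
qed

lemma norm_centre_le:
  fixes x :: "real ^ 'n"
  assumes "h > 0"
  shows "norm (x - h *\<^sub>R lattice_point (cell h x)) \<le> real CARD('n) * (h / 2)"
proof -
  have "\<bar>(x - h *\<^sub>R lattice_point (cell h x)) $ k\<bar> \<le> h / 2" for k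
  proof -
    have "\<bar>x $ k / h - real_of_int \<lfloor>x $ k / h + 1 / 2\<rfloor>\<bar> \<le> 1 / 2"
      by linarith
    then have "h * \<bar>x $ k / h - real_of_int \<lfloor>x $ k / h + 1 / 2\<rfloor>\<bar> \<le> h * (1 / 2)"
      using assms by (intro mult_left_mono) auto
    moreover have "h * \<bar>x $ k / h - real_of_int \<lfloor>x $ k / h + 1 / 2\<rfloor>\<bar>
        = \<bar>x $ k - h * real_of_int \<lfloor>x $ k / h + 1 / 2\<rfloor>\<bar>"
      using assms by (simp add: abs_mult_pos' right_diff_distrib)
    ultimately show ?thesis
      by (simp add: lattice_point_def cell_def)
  qed
  then have "(\<Sum>k\<in>UNIV. \<bar>(x - h *\<^sub>R lattice_point (cell h x)) $ k\<bar>) \<le> (\<Sum>k\<in>(UNIV :: 'n set). h / 2)"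
    by (intro sum_mono)
  then show ?thesis
    using norm_le_l1_cart[of "x - h *\<^sub>R lattice_point (cell h x)"] by simp
qed

lemma norm_same_cell_le:
  fixes x y :: "real ^ 'n"
  assumes "h > 0" "cell h x = cell h y"
  shows "norm (x - y) \<le> real CARD('n) * h"
  using norm_centre_le[OF assms(1), of x] norm_centre_le[OF assms(1), of y] assms(2)
    norm_triangle_ineq4[of "x - h *\<^sub>R lattice_point (cell h x)" "y - h *\<^sub>R lattice_point (cell h y)"]
  by simp

lemma cell_centre: "h > 0 \<Longrightarrow> cell h (h *\<^sub>R lattice_point i) = i"
  by (simp add: cell_def lattice_point_def vec_eq_iff floor_eq_iff)

lemma cell_scaleR: "h > 0 \<Longrightarrow> cell h (h *\<^sub>R x) = cell 1 x"
  by (simp add: cell_def)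

text \<open>With half-open cells the inequality is strict. Hence an edge between cells of mesh \<open>h\<close> that do
not touch is usable in the metric built from the edges of scope greater than \<open>h\<close>.\<close>

lemma norm_gt_of_cells_apart:
  fixes x y :: "real ^ 'n"
  assumes "h > 0" "\<bar>cell h x $ k - cell h y $ k\<bar> \<ge> 2"
  shows "norm (x - y) > h"
proof -
  have "\<bar>x $ k / h - y $ k / h\<bar> > 1"
    using assms(2) unfolding cell_def by simp linarith
  then have "\<bar>x $ k - y $ k\<bar> / h > 1"
    using assms by (simp add: diff_divide_distrib[symmetric])
  then have "\<bar>x $ k - y $ k\<bar> > h"
    using assms by simp
  then show ?thesis
    using component_le_norm_cart[of "x - y" k] by simp
qed

lemma measurable_cell [measurable]: "(cell h :: real ^ 'n \<Rightarrow> _) \<in> borel \<rightarrow>\<^sub>M count_space UNIV"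
proof -
  have "cell h -` {i} \<in> sets borel" for i :: "int ^ 'n"
  proof -
    have "cell h -` {i} = {x :: real ^ 'n. \<forall>k. \<lfloor>x $ k / h + 1 / 2\<rfloor> = i $ k}"
      by (auto simp: cell_def vec_eq_iff)
    also have "\<dots> \<in> sets borel"
      by measurable
    finally show ?thesis .
  qed
  then show ?thesis
    by (subst measurable_count_space_eq_countable) auto
qed

lemma cube_borel [measurable]: "cube h i \<in> sets borel"
  using measurable_sets[OF measurable_cell, of "{i}" h] by simp

lemma cube_sandwich:
  fixes i :: "int ^ 'n"
  shows "box (lattice_point i - (\<chi> k. 1 / 2)) (lattice_point i + (\<chi> k. 1 / 2)) \<subseteq> cube 1 i"
    and "cube 1 i \<subseteq> unit_cube i"
    and "unit_cube i = cbox (lattice_point i - (\<chi> k. 1 / 2)) (lattice_point i + (\<chi> k. 1 / 2))"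
proof -
  have *: "a - 1 / 2 < x \<and> x < a + 1 / 2 \<Longrightarrow> a \<le> x + 1 / 2 \<and> x + 1 / 2 < a + 1"
    "a \<le> x + 1 / 2 \<and> x + 1 / 2 < a + 1 \<Longrightarrow> \<bar>x - a\<bar> \<le> 1 / 2"
    "\<bar>x - a\<bar> \<le> 1 / 2 \<longleftrightarrow> a - 1 / 2 \<le> x \<and> x \<le> a + 1 / 2" for a x :: real
    by linarith+
  have cube: "cube 1 i = {x. \<forall>k. real_of_int (i $ k) \<le> x $ k + 1 / 2 \<and> x $ k + 1 / 2 < real_of_int (i $ k) + 1}"
    by (auto simp: cell_def vec_eq_iff floor_eq_iff)
  show "box (lattice_point i - (\<chi> k. 1 / 2)) (lattice_point i + (\<chi> k. 1 / 2)) \<subseteq> cube 1 i"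
  proof
    fix x assume "x \<in> box (lattice_point i - (\<chi> k. 1 / 2)) (lattice_point i + (\<chi> k. 1 / 2))"
    then have "\<forall>k. real_of_int (i $ k) - 1 / 2 < x $ k \<and> x $ k < real_of_int (i $ k) + 1 / 2"
      by (simp add: mem_box_cart lattice_point_def)
    then show "x \<in> cube 1 i"
      unfolding cube using *(1) by blast
  qed
  show "cube 1 i \<subseteq> unit_cube i"
    unfolding cube unit_cube_def using *(2) by blast
  show "unit_cube i = cbox (lattice_point i - (\<chi> k. 1 / 2)) (lattice_point i + (\<chi> k. 1 / 2))"
    unfolding unit_cube_def *(3) by (auto simp: mem_box_cart lattice_point_def)
qed

lemma emeasure_unit_cube: "emeasure lborel (unit_cube (i :: int ^ 'n)) = 1"
  unfolding cube_sandwich(3)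
  by (subst emeasure_lborel_cbox) (auto simp: Basis_vec_def inner_axis intro!: prod.neutral)

lemma AE_cube_iff_unit_cube:
  "AE x in lborel. x \<in> cube 1 (i :: int ^ 'n) \<longleftrightarrow> x \<in> unit_cube i"
proof -
  let ?a = "lattice_point i - (\<chi> k. 1 / 2)" and ?b = "lattice_point i + (\<chi> k. 1 / 2)"
  have "emeasure lborel (cbox ?a ?b - box ?a ?b) = 0"
    by (subst emeasure_Diff)
      (use emeasure_lborel_box_finite[of ?a ?b]
        in \<open>auto simp: box_subset_cbox emeasure_lborel_box_eq emeasure_lborel_cbox_eq\<close>)
  then have "cbox ?a ?b - box ?a ?b \<in> null_sets lborel"
    by auto
  then have "AE x in lborel. x \<notin> cbox ?a ?b - box ?a ?b"
    by (rule AE_not_in)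
  then show ?thesis
    by eventually_elim (use cube_sandwich[of i] in blast)
qed

lemma nn_integral_lborel_scaleR:
  fixes f :: "'a :: euclidean_space \<Rightarrow> ennreal"
  assumes "h > 0" and [measurable]: "f \<in> borel_measurable borel"
  shows "(\<integral>\<^sup>+x. f x \<partial>lborel) = ennreal (h ^ DIM('a)) * (\<integral>\<^sup>+x. f (h *\<^sub>R x) \<partial>lborel)"
  using assms
  by (subst lborel_affine[of h 0])
    (simp_all add: nn_integral_density nn_integral_distr nn_integral_cmult)

lemma lrp_intensity_measurable_Pair [measurable]:
  "(\<lambda>p :: (real ^ 'n) \<times> (real ^ 'n). lrp_intensity b (fst p) (snd p)) \<in> borel_measurable (borel \<Otimes>\<^sub>M borel)"
  unfolding lrp_intensity_def by measurable

lemma emeasure_cube: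
  assumes "h > 0"
  shows "emeasure lborel (cube h (i :: int ^ 'n)) = ennreal (h ^ CARD('n))"
proof -
  have "emeasure lborel (cube h i) = ennreal (h ^ CARD('n)) * (\<integral>\<^sup>+x. indicator (cube h i) (h *\<^sub>R x) \<partial>lborel)"
    using assms nn_integral_lborel_scaleR[OF assms, of "indicator (cube h i)"]
    by simp
  also have "(\<integral>\<^sup>+x. indicator (cube h i) (h *\<^sub>R x) \<partial>lborel) = (\<integral>\<^sup>+x. indicator (unit_cube i) x \<partial>lborel)"
    using AE_cube_iff_unit_cube[of i]
    by (intro nn_integral_cong_AE) (auto simp: cell_scaleR[OF assms] indicator_def)
  also have "\<dots> = 1"
    using emeasure_unit_cube[of i] by (simp add: cube_sandwich(3))
  finally show ?thesis by simp
qed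

lemma nn_integral_cube_eq:
  fixes f :: "real ^ 'n \<Rightarrow> ennreal"
  assumes "h > 0" and [measurable]: "f \<in> borel_measurable borel"
  shows "(\<integral>\<^sup>+x\<in>cube h i. f x \<partial>lborel) = ennreal (h ^ CARD('n)) * (\<integral>\<^sup>+x\<in>unit_cube i. f (h *\<^sub>R x) \<partial>lborel)"
proof -
  have "(\<integral>\<^sup>+x\<in>cube h i. f x \<partial>lborel)
      = ennreal (h ^ CARD('n)) * (\<integral>\<^sup>+x. f (h *\<^sub>R x) * indicator (cube h i) (h *\<^sub>R x) \<partial>lborel)"
    by (subst nn_integral_lborel_scaleR[OF assms(1)]) simp_all
  also have "(\<integral>\<^sup>+x. f (h *\<^sub>R x) * indicator (cube h i) (h *\<^sub>R x) \<partial>lborel)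
      = (\<integral>\<^sup>+x\<in>unit_cube i. f (h *\<^sub>R x) \<partial>lborel)"
    using AE_cube_iff_unit_cube[of i]
    by (intro nn_integral_cong_AE) (auto simp: cell_scaleR[OF assms(1)] indicator_def)
  finally show ?thesis .
qed

text \<open>Scale invariance of the model: rescaling both integration variables by \<open>h\<close> produces the factor
\<open>h ^ (2 d)\<close>, which the intensity, homogeneous of degree \<open>- 2 d\<close>, cancels.\<close>

lemma lrp_mean_cube:
  fixes i j :: "int ^ 'n"
  assumes "h > 0" "\<beta> > 0"
  shows "lrp_mean \<beta> (cube h i) (cube h j) = lrp_mean \<beta> (unit_cube i) (unit_cube j)"
proof -
  have [measurable]: "unit_cube j \<in> sets borel" "unit_cube i \<in> sets borel"
    by (simp_all add: cube_sandwich(3))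
  have sc: "lrp_intensity \<beta> (h *\<^sub>R x) (h *\<^sub>R y) = ennreal (1 / h ^ (2 * CARD('n))) * lrp_intensity \<beta> x y"
    for x y :: "real ^ 'n"
    using assms
    by (simp add: lrp_intensity_def scaleR_right_diff_distrib[symmetric] power_mult_distrib
        flip: ennreal_mult)
  have [measurable]: "(\<lambda>y. lrp_intensity \<beta> x y) \<in> borel_measurable borel" for x :: "real ^ 'n"
    unfolding lrp_intensity_def by measurable
  have "lrp_mean \<beta> (cube h i) (cube h j)
      = (\<integral>\<^sup>+x\<in>cube h i. (ennreal (h ^ CARD('n)) * (\<integral>\<^sup>+y\<in>unit_cube j. lrp_intensity \<beta> x (h *\<^sub>R y) \<partial>lborel)) \<partial>lborel)"
    unfolding lrp_mean_def by (subst nn_integral_cube_eq[OF assms(1), where i=j]) simp_all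
  also have "\<dots> = ennreal (h ^ CARD('n)) * (\<integral>\<^sup>+x\<in>unit_cube i.
      (ennreal (h ^ CARD('n)) * (\<integral>\<^sup>+y\<in>unit_cube j. lrp_intensity \<beta> (h *\<^sub>R x) (h *\<^sub>R y) \<partial>lborel)) \<partial>lborel)"
    by (rule nn_integral_cube_eq[OF assms(1)]) (simp add: lrp_intensity_def)
  also have "\<dots> = ennreal (h ^ CARD('n)) * (\<integral>\<^sup>+x. ennreal (h ^ CARD('n)) * ennreal (1 / h ^ (2 * CARD('n)))
      * ((\<integral>\<^sup>+y\<in>unit_cube j. lrp_intensity \<beta> x y \<partial>lborel) * indicator (unit_cube i) x) \<partial>lborel)"
    unfolding sc by (simp add: nn_integral_cmult mult.assoc)
  also have "\<dots> = ennreal (h ^ CARD('n)) * (ennreal (h ^ CARD('n)) * ennreal (1 / h ^ (2 * CARD('n))))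
      * lrp_mean \<beta> (unit_cube i) (unit_cube j)"
    unfolding lrp_mean_def by (subst nn_integral_cmult) (simp_all add: mult.assoc lrp_intensity_def)
  also have "ennreal (h ^ CARD('n)) * (ennreal (h ^ CARD('n)) * ennreal (1 / h ^ (2 * CARD('n)))) = 1"
    using assms by (simp flip: ennreal_mult add: power_mult power2_eq_square mult_2 power_add)
  finally show ?thesis by simp
qed

text \<open>An edge of the discrete model can be certain only between touching cubes, and these can be joined by a short
walk instead.\<close>

lemma lrp_mean_unit_cubes_finite:
  fixes i j :: "int ^ 'n"
  assumes "\<beta> > 0" and k: "\<bar>i $ k - j $ k\<bar> \<ge> 2"
  shows "lrp_mean \<beta> (unit_cube i) (unit_cube j) < \<infinity>"
proof -
  have bound: "lrp_intensity \<beta> x y \<le> ennreal \<beta>" if "x \<in> unit_cube i" "y \<in> unit_cube j" for x y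
  proof -
    have "\<bar>x $ k - real_of_int (i $ k)\<bar> \<le> 1 / 2" "\<bar>y $ k - real_of_int (j $ k)\<bar> \<le> 1 / 2"
      using that by (auto simp: unit_cube_def)
    then have "\<bar>x $ k - y $ k\<bar> \<ge> 1"
      using k by linarith
    then have "norm (x - y) \<ge> 1"
      using component_le_norm_cart[of "x - y" k] by simp
    then have "norm (x - y) ^ (2 * CARD('n)) \<ge> 1"
      by simp
    then have "\<beta> / norm (x - y) ^ (2 * CARD('n)) \<le> \<beta>"
      using assms(1) by (simp add: divide_le_eq)
    then show ?thesis
      by (simp add: lrp_intensity_def ennreal_leI)
  qed
  have "lrp_mean \<beta> (unit_cube i) (unit_cube j) \<le> (\<integral>\<^sup>+x\<in>unit_cube i. (\<integral>\<^sup>+y\<in>unit_cube j. ennreal \<beta> \<partial>lborel) \<partial>lborel)"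
    unfolding lrp_mean_def
    by (intro nn_integral_mono) (auto intro!: nn_integral_mono simp: bound split: split_indicator)
  also have "\<dots> = ennreal \<beta>"
    using emeasure_unit_cube[of i] emeasure_unit_cube[of j]
    by (simp add: nn_integral_cmult_indicator cube_sandwich(3))
  finally show ?thesis
    using le_less_trans by fastforce
qed

section \<open>Graph distances\<close>

abbreviation adj :: "'v set set \<Rightarrow> ('v \<times> 'v) set" where
  "adj E \<equiv> {(x, y). {x, y} \<in> E}"

lemma graph_dist_le: "(i, j) \<in> adj E ^^ m \<Longrightarrow> graph_dist E i j \<le> m"
  unfolding graph_dist_def by (rule Least_le)

lemma graph_dist_attained: "(i, j) \<in> adj E ^^ m \<Longrightarrow> (i, j) \<in> adj E ^^ graph_dist E i j"
  unfolding graph_dist_def by (rule LeastI)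

lemma norm1_nonneg: "norm1 i \<ge> 0"
  by (simp add: norm1_def sum_nonneg)

lemma norm1_eq_0_iff: "norm1 i = 0 \<longleftrightarrow> i = 0"
  by (simp add: norm1_def sum_nonneg_eq_0_iff vec_eq_iff)

lemma norm1_minus_commute: "norm1 (i - j) = norm1 (j - i)"
  unfolding norm1_def by (intro sum.cong refl) (simp add: abs_minus_commute)

definition near_pairs :: "(int ^ 'n) set set" where
  "near_pairs = {{i, j} | i j. norm1 (i - j) = 1}"

definition long_pairs :: "(int ^ 'n) set set" where
  "long_pairs = {{i, j} | i j. norm1 (i - j) > 1}"

lemma lattice_walk:
  fixes i j :: "int ^ 'n"
  assumes "near_pairs \<subseteq> E"
  shows "(i, j) \<in> adj E ^^ nat (norm1 (i - j))"
proof (induction "nat (norm1 (i - j))" arbitrary: i)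
  case 0
  then show ?case
    using norm1_nonneg[of "i - j"] norm1_eq_0_iff[of "i - j"] by simp
next
  case (Suc m)
  then have "i \<noteq> j"
    using norm1_eq_0_iff[of "i - j"] by auto
  then obtain k where k: "i $ k \<noteq> j $ k"
    by (auto simp: vec_eq_iff)
  \<comment> \<open>One step from \<open>i\<close> towards \<open>j\<close> in a coordinate where they differ.\<close>
  define i' where "i' = (\<chi> l. if l = k then i $ k + sgn (j $ k - i $ k) else i $ l)"
  have "norm1 (i - i') = (\<Sum>l\<in>UNIV. if l = k then 1 else 0)"
    unfolding norm1_def by (intro sum.cong) (use k in \<open>auto simp: i'_def abs_sgn_eq\<close>)
  then have step: "norm1 (i - i') = 1"
    by simp
  have "norm1 (i - j) = \<bar>i $ k - j $ k\<bar> + (\<Sum>l\<in>UNIV - {k}. \<bar>(i - j) $ l\<bar>)"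
    unfolding norm1_def by (subst sum.remove[of _ k]) auto
  moreover have "norm1 (i' - j) = \<bar>i' $ k - j $ k\<bar> + (\<Sum>l\<in>UNIV - {k}. \<bar>(i - j) $ l\<bar>)"
    unfolding norm1_def by (subst sum.remove[of _ k]) (auto intro!: sum.cong simp: i'_def)
  moreover have "\<bar>i' $ k - j $ k\<bar> = \<bar>i $ k - j $ k\<bar> - 1"
    using k by (auto simp: i'_def sgn_if)
  ultimately have less: "norm1 (i' - j) = norm1 (i - j) - 1"
    by simp
  then have "m = nat (norm1 (i' - j))"
    using Suc.hyps(2) by simp
  then have "(i', j) \<in> adj E ^^ m"
    using Suc.hyps(1) by blast
  moreover have "{i, i'} \<in> E"
    using step assms by (auto simp: near_pairs_def)
  ultimately have "(i, j) \<in> adj E ^^ Suc m"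
    by (intro relpow_Suc_I2[of i i']) auto
  then show ?case
    using Suc.hyps(2) by simp
qed

section \<open>Uniqueness in law of the discrete model\<close>

lemma long_pairs_nonempty: "(long_pairs :: (int ^ 'n) set set) \<noteq> {}"
proof -
  have "CARD('n) > 0"
    by simp
  then have "norm1 (0 - (\<chi> k. 2) :: int ^ 'n) > 1"
    by (simp add: norm1_def del: zero_less_card_finite)
  then show ?thesis
    unfolding long_pairs_def by blast
qed

context discrete_lrp
begin

lemma G_eq: "\<omega> \<in> space M \<Longrightarrow> G \<omega> = near_pairs \<union> {e \<in> long_pairs. e \<in> G \<omega>}"
proof (intro set_eqI iffI)
  fix e assume \<omega>: "\<omega> \<in> space M" and "e \<in> G \<omega>"
  then obtain i j where ij: "e = {i, j}" "i \<noteq> j"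
    using edges by blast
  then have "norm1 (i - j) \<noteq> 0"
    using norm1_eq_0_iff[of "i - j"] by auto
  then have "norm1 (i - j) = 1 \<or> norm1 (i - j) > 1"
    using norm1_nonneg[of "i - j"] by linarith
  then show "e \<in> near_pairs \<union> {e \<in> long_pairs. e \<in> G \<omega>}"
    using ij \<open>e \<in> G \<omega>\<close> unfolding near_pairs_def long_pairs_def by blast
qed (auto simp: near_pairs_def nearest_neighbours)

lemma measurable_edge:
  assumes "e \<in> long_pairs"
  shows "(\<lambda>\<omega>. e \<in> G \<omega>) \<in> M \<rightarrow>\<^sub>M count_space UNIV"
proof -
  have "{\<omega> \<in> space M. e \<in> G \<omega>} \<in> events"
    using long_edges_indep assms unfolding indep_events_def long_pairs_def by blast
  then show ?thesis
    by (simp add: pred_def)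
qed

lemma indep_vars_edges: "indep_vars (\<lambda>_. count_space UNIV) (\<lambda>e \<omega>. e \<in> G \<omega>) long_pairs"
  unfolding indep_vars_def2
proof (intro conjI ballI measurable_edge)
  let ?F = "\<lambda>e. {{\<omega> \<in> space M. e \<in> G \<omega>}}"
  have "indep_sets (\<lambda>e. sigma_sets (space M) (?F e)) long_pairs"
    using long_edges_indep unfolding indep_events_def_alt long_pairs_def
    by (intro indep_sets_sigma) (auto simp: Int_stable_def)
  then show "indep_sets (\<lambda>e. {(\<lambda>\<omega>. e \<in> G \<omega>) -` A \<inter> space M | A. A \<in> sets (count_space UNIV)}) long_pairs"
  proof (rule indep_sets_mono_sets)
    fix e :: "(int ^ 'n) set"
    let ?S = "sigma_sets (space M) (?F e)"
    have 1: "{\<omega> \<in> space M. e \<in> G \<omega>} \<in> ?S"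
      by (rule sigma_sets.Basic) simp
    have 2: "{\<omega> \<in> space M. e \<notin> G \<omega>} \<in> ?S"
      using sigma_sets.Compl[OF 1] by (rule back_subst[of "\<lambda>A. A \<in> ?S"]) auto
    have 3: "space M \<in> ?S"
      by (rule sigma_sets_top)
    show "{(\<lambda>\<omega>. e \<in> G \<omega>) -` A \<inter> space M | A. A \<in> sets (count_space UNIV)} \<subseteq> ?S"
    proof clarify
      fix A :: "bool set"
      consider "A = {}" | "A = {True}" | "A = {False}" | "A = UNIV"
        by (metis (full_types) UNIV_bool empty_iff insertI1 is_singletonI' is_singleton_def
            subset_UNIV subset_antisym subsetI insert_iff)
      then show "(\<lambda>\<omega>. e \<in> G \<omega>) -` A \<inter> space M \<in> ?S"
      proof cases
        case 1 then show ?thesis by (simp add: sigma_sets.Empty)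
      next
        case c: 2
        have "(\<lambda>\<omega>. e \<in> G \<omega>) -` A \<inter> space M = {\<omega> \<in> space M. e \<in> G \<omega>}"
          using c by auto
        then show ?thesis using 1 by simp
      next
        case c: 3
        have "(\<lambda>\<omega>. e \<in> G \<omega>) -` A \<inter> space M = {\<omega> \<in> space M. e \<notin> G \<omega>}"
          using c by auto
        then show ?thesis using 2 by simp
      next
        case 4 then show ?thesis using 3 by simp
      qed
    qed
  qed
qed

definition config :: "'w \<Rightarrow> (int ^ 'n) set \<Rightarrow> bool" where
  "config \<omega> = (\<lambda>e\<in>long_pairs. e \<in> G \<omega>)"

lemma measurable_config: "config \<in> M \<rightarrow>\<^sub>M (\<Pi>\<^sub>M e\<in>long_pairs. count_space UNIV)"
  unfolding config_def by (intro measurable_restrict measurable_edge)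

lemma distr_config:
  "distr M (\<Pi>\<^sub>M e\<in>long_pairs. count_space UNIV) config
     = (\<Pi>\<^sub>M e\<in>long_pairs. distr M (count_space UNIV) (\<lambda>\<omega>. e \<in> G \<omega>))"
  unfolding config_def
  by (rule indep_vars_iff_distr_eq_PiM'[THEN iffD1, OF long_pairs_nonempty measurable_edge indep_vars_edges])

end

lemma distr_pred_eqI:
  assumes "prob_space M" "prob_space M'"
    and P: "P \<in> M \<rightarrow>\<^sub>M count_space UNIV" and P': "P' \<in> M' \<rightarrow>\<^sub>M count_space UNIV"
    and eq: "measure M {\<omega> \<in> space M. P \<omega>} = measure M' {\<omega> \<in> space M'. P' \<omega>}"
  shows "distr M (count_space (UNIV :: bool set)) P = distr M' (count_space UNIV) P'"
proof -
  interpret M: prob_space M by fact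
  interpret M': prob_space M' by fact
  show ?thesis
  proof (rule measure_eqI_countable[where A=UNIV])
    fix b :: bool
    have T: "P -` {True} \<inter> space M = {\<omega> \<in> space M. P \<omega>}" "P' -` {True} \<inter> space M' = {\<omega> \<in> space M'. P' \<omega>}"
      by auto
    have F: "P -` {False} \<inter> space M = space M - {\<omega> \<in> space M. P \<omega>}"
      "P' -` {False} \<inter> space M' = space M' - {\<omega> \<in> space M'. P' \<omega>}"
      by auto
    have s: "{\<omega> \<in> space M. P \<omega>} \<in> sets M" "{\<omega> \<in> space M'. P' \<omega>} \<in> sets M'"
      using P P' by (auto simp: pred_def)
    show "emeasure (distr M (count_space UNIV) P) {b} = emeasure (distr M' (count_space UNIV) P') {b}"
      using P P' s eq
      by (cases b) (simp_all add: emeasure_distr T F M.emeasure_eq_measure M'.emeasure_eq_measure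
          M.prob_compl M'.prob_compl del: vimage_singleton_eq)
  qed auto
qed

definition config_dist :: "((int ^ 'n) set \<Rightarrow> bool) \<Rightarrow> int ^ 'n \<Rightarrow> int ^ 'n \<Rightarrow> nat" where
  "config_dist c i j = graph_dist (near_pairs \<union> {e \<in> long_pairs. c e}) i j"

text \<open>There are only countably many paths, and each of them depends on finitely many edges.\<close>

lemma measurable_config_dist:
  "(\<lambda>c. config_dist c i j) \<in> (\<Pi>\<^sub>M e\<in>long_pairs. count_space UNIV) \<rightarrow>\<^sub>M count_space UNIV"
proof -
  let ?P = "\<Pi>\<^sub>M e\<in>(long_pairs :: (int ^ 'n) set set). count_space (UNIV :: bool set)"
  let ?E = "\<lambda>c. near_pairs \<union> {e \<in> long_pairs. c e}"
  have e [measurable]: "(\<lambda>c. {x, y} \<in> ?E c) \<in> ?P \<rightarrow>\<^sub>M count_space UNIV" for x y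
  proof (cases "{x, y} \<in> long_pairs")
    case True
    then show ?thesis
      by (cases "{x, y} \<in> near_pairs") (auto intro: measurable_component_singleton)
  qed auto
  have [measurable]: "(\<lambda>c. (x, y) \<in> adj (?E c) ^^ m) \<in> ?P \<rightarrow>\<^sub>M count_space UNIV" for m x y
  proof (induction m arbitrary: y)
    case (Suc m)
    have [measurable]: "(\<lambda>c. (x, z) \<in> adj (?E c) ^^ m) \<in> ?P \<rightarrow>\<^sub>M count_space UNIV" for z
      by (rule Suc)
    have "(\<lambda>c. (x, y) \<in> adj (?E c) ^^ Suc m) = (\<lambda>c. \<exists>z. (x, z) \<in> adj (?E c) ^^ m \<and> {z, y} \<in> ?E c)"
      by (auto simp: relcomp_unfold)
    then show ?case
      by (simp only:) measurable
  qed simp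
  show ?thesis
    unfolding config_dist_def graph_dist_def by measurable
qed

text \<open>The axioms of the discrete model fix the probabilities of the long edges and their independence, hence the
joint law of the countable family of indicators of long edges. The nearest-neighbour edges are deterministic,
so graph distances are functions of this family.\<close>

lemma measure_graph_dist_eq:
  fixes G :: "'w \<Rightarrow> (int ^ 'n) set set" and G' :: "'v \<Rightarrow> (int ^ 'n) set set"
  assumes "discrete_lrp M \<beta> G" "discrete_lrp M' \<beta> G'"
  shows "measure M {\<omega> \<in> space M. Q (graph_dist (G \<omega>) i j)} = measure M' {\<omega> \<in> space M'. Q (graph_dist (G' \<omega>) i j)}"
    and "{\<omega> \<in> space M. Q (graph_dist (G \<omega>) i j)} \<in> sets M"
proof -
  interpret G: discrete_lrp M \<beta> G by fact
  interpret G': discrete_lrp M' \<beta> G' by fact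
  let ?P = "\<Pi>\<^sub>M e\<in>(long_pairs :: (int ^ 'n) set set). count_space (UNIV :: bool set)"
  have D: "graph_dist (G \<omega>) i j = config_dist (G.config \<omega>) i j" if "\<omega> \<in> space M" for \<omega>
    unfolding config_dist_def G.config_def
    by (subst G.G_eq[OF that]) (auto intro!: arg_cong2[where f="\<lambda>A. graph_dist A i"])
  have D': "graph_dist (G' \<omega>) i j = config_dist (G'.config \<omega>) i j" if "\<omega> \<in> space M'" for \<omega>
    unfolding config_dist_def G'.config_def
    by (subst G'.G_eq[OF that]) (auto intro!: arg_cong2[where f="\<lambda>A. graph_dist A i"])
  let ?A = "(\<lambda>c. config_dist c i j) -` {m. Q m} \<inter> space ?P"
  have A: "?A \<in> sets ?P"
    using measurable_config_dist by (rule measurable_sets) auto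
  have pre: "{\<omega> \<in> space M. Q (graph_dist (G \<omega>) i j)} = G.config -` ?A \<inter> space M"
    using measurable_space[OF G.measurable_config] D by auto
  have pre': "{\<omega> \<in> space M'. Q (graph_dist (G' \<omega>) i j)} = G'.config -` ?A \<inter> space M'"
    using measurable_space[OF G'.measurable_config] D' by auto
  show "{\<omega> \<in> space M. Q (graph_dist (G \<omega>) i j)} \<in> sets M"
    unfolding pre using G.measurable_config A by (rule measurable_sets)
  have "distr M (count_space UNIV) (\<lambda>\<omega>. e \<in> G \<omega>) = distr M' (count_space UNIV) (\<lambda>\<omega>. e \<in> G' \<omega>)"
    if e: "e \<in> long_pairs" for e
  proof (intro distr_pred_eqI G.measurable_edge G'.measurable_edge e)
    obtain x y where "e = {x, y}" "norm1 (x - y) > 1"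
      using e by (auto simp: long_pairs_def)
    then show "measure M {\<omega> \<in> space M. e \<in> G \<omega>} = measure M' {\<omega> \<in> space M'. e \<in> G' \<omega>}"
      using G.long_edges_prob G'.long_edges_prob by simp
  qed unfold_locales
  then have "distr M ?P G.config = distr M' ?P G'.config"
    unfolding G.distr_config G'.distr_config by (intro PiM_cong) auto
  then have "measure (distr M ?P G.config) ?A = measure (distr M' ?P G'.config) ?A"
    by simp
  then show "measure M {\<omega> \<in> space M. Q (graph_dist (G \<omega>) i j)} = measure M' {\<omega> \<in> space M'. Q (graph_dist (G' \<omega>) i j)}"
    unfolding pre pre'
    using measure_distr[OF G.measurable_config A] measure_distr[OF G'.measurable_config A] by simp
qed

section \<open>Continuous paths\<close>

lemma path_cost_nonneg: "path_cost x es y \<ge> 0"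
  by (induction x es y rule: path_cost.induct) auto

lemma path_cost_triangle: "path_cost x es y \<le> norm (x - z) + path_cost z es y"
  by (cases es) (use norm_triangle_ineq[of "x - z" "z - _"] in \<open>auto intro: order.trans\<close>)

lemma path_cost_append_Cons:
  "path_cost x (es @ (u, v) # fs) y = path_cost x es u + path_cost v fs y"
  by (induction es arbitrary: x) auto

lemma path_cost_append_le: "path_cost x (es @ fs) y \<le> path_cost x es z + path_cost z fs y"
  by (induction es arbitrary: x) (auto simp: path_cost_triangle)

definition admissible :: "real \<Rightarrow> (real ^ 'n) set set \<Rightarrow> ((real ^ 'n) \<times> (real ^ 'n)) list \<Rightarrow> bool" where
  "admissible \<delta> E es \<longleftrightarrow> (\<forall>(u, v)\<in>set es. {u, v} \<in> E \<and> norm (u - v) > \<delta>)"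

lemma lrp_dist_eq_INF: "lrp_dist \<delta> E x y = (INF es\<in>{es. admissible \<delta> E es}. path_cost x es y)"
  by (simp add: lrp_dist_def admissible_def)

lemma lrp_dist_le: "admissible \<delta> E es \<Longrightarrow> lrp_dist \<delta> E x y \<le> path_cost x es y"
  unfolding lrp_dist_eq_INF
  by (rule cINF_lower) (auto intro!: bdd_belowI[of _ 0] simp: path_cost_nonneg)

lemma lrp_dist_approx:
  assumes "lrp_dist \<delta> E x y < r"
  obtains es where "admissible \<delta> E es" "path_cost x es y < r"
proof -
  have "admissible \<delta> E []"
    by (simp add: admissible_def)
  then have "(INF es\<in>{es. admissible \<delta> E es}. path_cost x es y) < r \<longleftrightarrow> (\<exists>es\<in>{es. admissible \<delta> E es}. path_cost x es y < r)"
    by (intro cINF_less_iff) (auto intro!: bdd_belowI[of _ 0] simp: path_cost_nonneg)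
  then show thesis
    using assms that unfolding lrp_dist_eq_INF by auto
qed

abbreviation undirected :: "'a \<times> 'a \<Rightarrow> 'a set" where
  "undirected \<equiv> \<lambda>(u, v). {u, v}"

text \<open>Between two traversals of the same edge the path makes a detour: if both go in the same direction, everything
from the first traversal up to the second can be skipped; if they go in opposite directions, both traversals
can be skipped as well. A path with the least number of edges among those that cost no more than the given one
therefore repeats no edge.\<close>

lemma distinct_edges:
  assumes "admissible \<delta> E es"
  obtains fs where "admissible \<delta> E fs" "path_cost x fs y \<le> path_cost x es y" "distinct (map undirected fs)"
proof -
  define P where "P fs \<longleftrightarrow> admissible \<delta> E fs \<and> path_cost x fs y \<le> path_cost x es y" for fs
  have "P es"
    using assms by (simp add: P_def)
  then obtain fs where fs: "P fs" and shortest: "\<And>gs. P gs \<Longrightarrow> length fs \<le> length gs"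
    using ex_has_least_nat[of P es length] by blast
  have "distinct (map undirected fs)"
  proof (rule ccontr)
    assume "\<not> distinct (map undirected fs)"
    then obtain as bs cs e where "map undirected fs = as @ [e] @ bs @ [e] @ cs"
      using not_distinct_decomp by blast
    then obtain ps qs rs u v u' v' where split: "fs = ps @ (u, v) # qs @ (u', v') # rs" and "{u, v} = {u', v'}"
      by (fastforce simp: map_eq_append_conv map_eq_Cons_conv append_eq_map_conv Cons_eq_map_conv)
    then consider "u' = u" "v' = v" | "u' = v" "v' = u"
      by (auto simp: doubleton_eq_iff)
    then show False
    proof cases
      case 1
      have "path_cost x (ps @ (u, v) # rs) y \<le> path_cost x fs y"
        using path_cost_nonneg[of v qs u] unfolding split 1 path_cost_append_Cons by simp
      then have "P (ps @ (u, v) # rs)"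
        using fs unfolding P_def admissible_def split by auto
      then show False
        using shortest split by fastforce
    next
      case 2
      have "path_cost x (ps @ rs) y \<le> path_cost x fs y"
        using path_cost_nonneg[of v qs v] path_cost_append_le[of x ps rs y u]
        unfolding split 2 path_cost_append_Cons by simp
      then have "P (ps @ rs)"
        using fs unfolding P_def admissible_def split by auto
      then show False
        using shortest split by fastforce
    qed
  qed
  then show thesis
    using fs that unfolding P_def by blast
qed

section \<open>Counts of a Poisson point process\<close>

context poisson_point_process
begin

text \<open>An infinite set counts as having at least \<open>k\<close> points. This makes the event the complement of a
finite union of count events, while \<^const>\<open>card\<close> would put an infinite set on the wrong side.\<close>

definition at_least :: "'a set \<Rightarrow> nat \<Rightarrow> 'w set" where
  "at_least A k = {\<omega> \<in> space M. \<not> (finite (N \<omega> \<inter> A) \<and> card (N \<omega> \<inter> A) < k)}"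

lemma AE_finite_count:
  assumes "A \<in> sets \<mu>" "emeasure \<mu> A < \<infinity>"
  shows "AE \<omega> in M. finite (N \<omega> \<inter> A)"
proof -
  let ?C = "\<lambda>k. {\<omega> \<in> space M. finite (N \<omega> \<inter> A) \<and> card (N \<omega> \<inter> A) = k}"
  have "(\<lambda>k. prob (?C k)) sums prob (\<Union>k. ?C k)"
    using count_events[OF assms] by (intro finite_measure_UNION) (auto simp: disjoint_family_on_def)
  moreover have "(\<lambda>k. prob (?C k)) sums 1"
  proof -
    have "(\<lambda>k. measure \<mu> A ^ k / fact k * exp (- measure \<mu> A)) sums (exp (measure \<mu> A) * exp (- measure \<mu> A))"
      using exp_converges[of "measure \<mu> A"] by (intro sums_mult2) (simp add: divide_inverse mult.commute)
    then show ?thesis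
      using count_poisson[OF assms] by (simp add: exp_minus_inverse)
  qed
  ultimately have "prob (\<Union>k. ?C k) = 1"
    by (rule sums_unique2)
  moreover have "(\<Union>k. ?C k) = {\<omega> \<in> space M. finite (N \<omega> \<inter> A)}"
    by auto
  ultimately have "prob {\<omega> \<in> space M. finite (N \<omega> \<inter> A)} = 1"
    by simp
  then have "AE \<omega> in M. \<omega> \<in> {\<omega> \<in> space M. finite (N \<omega> \<inter> A)}"
    by (rule AE_prob_1)
  then show ?thesis
    by eventually_elim simp
qed

lemma at_least_eq_compl:
  "at_least A k = space M - (\<Union>j<k. {\<omega> \<in> space M. finite (N \<omega> \<inter> A) \<and> card (N \<omega> \<inter> A) = j})"
  unfolding at_least_def by auto

lemma at_least_event [measurable]:
  assumes "A \<in> sets \<mu>" "emeasure \<mu> A < \<infinity>"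
  shows "at_least A k \<in> events"
  unfolding at_least_eq_compl using count_events[OF assms] by auto

lemma prob_at_least:
  assumes "A \<in> sets \<mu>" "emeasure \<mu> A < \<infinity>"
  shows "prob (at_least A k) = 1 - (\<Sum>j<k. measure \<mu> A ^ j / fact j * exp (- measure \<mu> A))"
proof -
  let ?C = "\<lambda>k. {\<omega> \<in> space M. finite (N \<omega> \<inter> A) \<and> card (N \<omega> \<inter> A) = k}"
  have C: "?C j \<in> events" for j
    using count_events[OF assms] .
  have "prob (\<Union>j<k. ?C j) = (\<Sum>j<k. prob (?C j))"
    using C by (intro finite_measure_finite_Union) (auto simp: disjoint_family_on_def)
  then show ?thesis
    unfolding at_least_eq_compl using C by (subst prob_compl) (auto simp: count_poisson[OF assms])
qed

text \<open>The remainder of the exponential series after \<open>k\<close> terms. This bound is what replaces a factorial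
moment when several edges of one path lie over the same pair of cells.\<close>

lemma prob_at_least_le:
  assumes "A \<in> sets \<mu>" "emeasure \<mu> A < \<infinity>"
  shows "prob (at_least A k) \<le> measure \<mu> A ^ k"
proof -
  let ?m = "measure \<mu> A"
  obtain t where t: "\<bar>t\<bar> \<le> \<bar>?m\<bar>" and e: "exp ?m = (\<Sum>j<k. ?m ^ j / fact j) + exp t / fact k * ?m ^ k"
    using Maclaurin_exp_le[of ?m k] by blast
  have "1 = exp ?m * exp (- ?m)"
    by (simp add: exp_minus_inverse)
  also have "\<dots> = (\<Sum>j<k. ?m ^ j / fact j * exp (- ?m)) + exp t / fact k * ?m ^ k * exp (- ?m)"
    unfolding e distrib_right sum_distrib_right ..
  finally have "prob (at_least A k) = exp (t - ?m) / fact k * ?m ^ k"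
    unfolding prob_at_least[OF assms] by (simp add: exp_diff exp_minus divide_inverse ac_simps)
  also have "\<dots> \<le> 1 * ?m ^ k"
  proof (intro mult_right_mono)
    have "exp (t - ?m) \<le> 1"
      using t by simp
    also have "1 \<le> (fact k :: real)"
      by simp
    finally show "exp (t - ?m) / fact k \<le> 1"
      by simp
  qed simp
  finally show ?thesis by simp
qed

text \<open>Independence is available for the counts \<^const>\<open>card\<close>, with index sets of natural numbers; the
events here differ from events about these counts on the null set where some intersection is infinite.\<close>

lemma prob_all_at_least:
  assumes "finite I" and disj: "disjoint_family_on B I"
    and B: "\<And>i. i \<in> I \<Longrightarrow> B i \<in> sets \<mu> \<and> emeasure \<mu> (B i) < \<infinity>"
  shows "prob {\<omega> \<in> space M. \<forall>i\<in>I. \<omega> \<in> at_least (B i) (k i)} = (\<Prod>i\<in>I. prob (at_least (B i) (k i)))"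
proof (cases "I = {}")
  case True
  then show ?thesis by (simp add: prob_space)
next
  case False
  obtain g :: "_ \<Rightarrow> nat" where g: "inj_on g I"
    using finite_imp_inj_to_nat_seg[OF \<open>finite I\<close>] by blast
  \<comment> \<open>An enumeration of \<open>I\<close> transports the family to an index set of natural numbers.\<close>
  define f where "f = the_inv_into I g"
  have f: "f (g i) = i" if "i \<in> I" for i
    using that g by (simp add: f_def the_inv_into_f_f)
  have meas: "(\<lambda>\<omega>. card (N \<omega> \<inter> B i)) \<in> M \<rightarrow>\<^sub>M count_space UNIV"
    and iv: "indep_vars (\<lambda>_. count_space UNIV) (\<lambda>j \<omega>. card (N \<omega> \<inter> B (f j))) (g ` I)" if "i \<in> I" for i
  proof -
    show iv: "indep_vars (\<lambda>_. count_space UNIV) (\<lambda>j \<omega>. card (N \<omega> \<inter> B (f j))) (g ` I)"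
    proof (rule count_indep)
      show "disjoint_family_on (\<lambda>j. B (f j)) (g ` I)"
        unfolding disjoint_family_on_def
      proof (intro ballI impI)
        fix j j' assume "j \<in> g ` I" "j' \<in> g ` I" "j \<noteq> j'"
        then obtain i i' where "i \<in> I" "i' \<in> I" "j = g i" "j' = g i'" "i \<noteq> i'"
          by blast
        then show "B (f j) \<inter> B (f j') = {}"
          using disj by (simp add: f disjoint_family_on_def)
      qed
    qed (use B \<open>finite I\<close> in \<open>auto simp: f\<close>)
    then show "(\<lambda>\<omega>. card (N \<omega> \<inter> B i)) \<in> M \<rightarrow>\<^sub>M count_space UNIV"
      using that unfolding indep_vars_def by (auto simp: f)
  qed
  let ?X = "\<lambda>i. (\<lambda>\<omega>. card (N \<omega> \<inter> B i)) -` {k i..} \<inter> space M"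
  have X: "?X i \<in> events" if "i \<in> I" for i
    using meas[OF that] by (rule measurable_sets) simp
  have AEi: "AE \<omega> in M. \<omega> \<in> at_least (B i) (k i) \<longleftrightarrow> \<omega> \<in> ?X i" if "i \<in> I" for i
  proof -
    have "AE \<omega> in M. finite (N \<omega> \<inter> B i)"
      using B[OF that] by (intro AE_finite_count) auto
    then show ?thesis
      using AE_space by eventually_elim (simp add: at_least_def not_less)
  qed
  have "AE \<omega> in M. \<forall>i\<in>I. \<omega> \<in> at_least (B i) (k i) \<longleftrightarrow> \<omega> \<in> ?X i"
    using \<open>finite I\<close> AEi by (intro AE_finite_allI)
  then have "prob {\<omega> \<in> space M. \<forall>i\<in>I. \<omega> \<in> at_least (B i) (k i)} = prob (\<Inter>i\<in>I. ?X i)"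
  proof (intro finite_measure_eq_AE)
    show "AE \<omega> in M. \<omega> \<in> {\<omega> \<in> space M. \<forall>i\<in>I. \<omega> \<in> at_least (B i) (k i)} \<longleftrightarrow> \<omega> \<in> (\<Inter>i\<in>I. ?X i)"
      if "AE \<omega> in M. \<forall>i\<in>I. \<omega> \<in> at_least (B i) (k i) \<longleftrightarrow> \<omega> \<in> ?X i"
      using that AE_space
    proof eventually_elim
      case (elim \<omega>)
      then show ?case
        using False by blast
    qed
    show "{\<omega> \<in> space M. \<forall>i\<in>I. \<omega> \<in> at_least (B i) (k i)} \<in> events"
    proof -
      have "{\<omega> \<in> space M. \<forall>i\<in>I. \<omega> \<in> at_least (B i) (k i)} = (\<Inter>i\<in>I. at_least (B i) (k i))"
        using False by (auto simp: at_least_def)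
      then show ?thesis
        using B \<open>finite I\<close> False by (simp only:) (intro sets.finite_INT at_least_event, auto)
    qed
    show "(\<Inter>i\<in>I. ?X i) \<in> events"
      using X \<open>finite I\<close> False by (intro sets.finite_INT) auto
  qed
  also have "(\<Inter>i\<in>I. ?X i) = (\<Inter>j\<in>g ` I. (\<lambda>\<omega>. card (N \<omega> \<inter> B (f j))) -` {k (f j)..} \<inter> space M)"
    by (auto simp: f)
  also have "prob \<dots> = (\<Prod>j\<in>g ` I. prob ((\<lambda>\<omega>. card (N \<omega> \<inter> B (f j))) -` {k (f j)..} \<inter> space M))"
    using iv False \<open>finite I\<close> by (intro indep_varsD_finite) auto
  also have "\<dots> = (\<Prod>i\<in>I. prob (?X i))"
    using g by (subst prod.reindex) (auto simp: f)
  also have "\<dots> = (\<Prod>i\<in>I. prob (at_least (B i) (k i)))"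
  proof (intro prod.cong refl finite_measure_eq_AE)
    fix i assume "i \<in> I"
    show "AE \<omega> in M. \<omega> \<in> ?X i \<longleftrightarrow> \<omega> \<in> at_least (B i) (k i)"
      using AEi[OF \<open>i \<in> I\<close>] by eventually_elim blast
    show "?X i \<in> events" "at_least (B i) (k i) \<in> events"
      using X[OF \<open>i \<in> I\<close>] B[OF \<open>i \<in> I\<close>] by (simp_all add: at_least_event)
  qed
  finally show ?thesis .
qed

end

section \<open>The discrete model inside the continuous one\<close>

definition edges_over :: "real \<Rightarrow> (int ^ 'n) set \<Rightarrow> (real ^ 'n) set set" where
  "edges_over h e = {{x, y} | x y. {cell h x, cell h y} = e}"

lemma doubleton_in_edges_over: "{x, y} \<in> edges_over h e \<longleftrightarrow> {cell h x, cell h y} = e"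
  unfolding edges_over_def by (auto simp: doubleton_eq_iff)

lemma edges_over_pair: "edges_over h {i, j} = {{x, y} | x y. x \<in> cube h i \<and> y \<in> cube h j}"
proof (intro set_eqI iffI)
  fix f assume "f \<in> edges_over h {i, j}"
  then obtain x y where f: "f = {x, y}" and "{cell h x, cell h y} = {i, j}"
    by (auto simp: edges_over_def)
  then consider "cell h x = i" "cell h y = j" | "cell h y = i" "cell h x = j"
    by (auto simp: doubleton_eq_iff)
  then show "f \<in> {{x, y} | x y. x \<in> cube h i \<and> y \<in> cube h j}"
  proof cases
    case 1
    then show ?thesis using f by blast
  next
    case 2
    moreover have "f = {y, x}"
      using f by blast
    ultimately show ?thesis by blast
  qed
qed (auto simp: edges_over_def)

lemma disjoint_edges_over: "disjoint_family_on (edges_over h) I"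
  unfolding disjoint_family_on_def
proof (intro ballI impI)
  fix e e' :: "(int ^ 'n) set" assume "e \<noteq> e'"
  then show "edges_over h e \<inter> edges_over h e' = {}"
    unfolding edges_over_def[of h e] by (auto simp: doubleton_in_edges_over)
qed

lemma sets_lrp_edge_measure: "sets (lrp_edge_measure \<beta>) = sets edge_algebra"
  by (simp add: lrp_edge_measure_def)

lemma edges_over_sets: "edges_over h {i, j} \<in> sets (lrp_edge_measure \<beta>)"
proof -
  have "(\<lambda>(x, y). {x, y}) -` edges_over h {i, j} = cube h i \<times> cube h j \<union> cube h j \<times> cube h i"
    by (simp add: set_eq_iff[where A = "_ -` _"] split_paired_all doubleton_in_edges_over doubleton_eq_iff)
  then show ?thesis
    unfolding sets_lrp_edge_measure sets_edge_algebra by (auto intro!: borel_Times sets.Un)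
qed

lemma emeasure_edges_over_cubes:
  assumes "\<beta> > 0" "i \<noteq> j"
  shows "emeasure (lrp_edge_measure \<beta>) (edges_over h {i, j}) = lrp_mean \<beta> (cube h i) (cube h j)"
  unfolding edges_over_pair using assms by (intro emeasure_lrp_edge_measure) auto

lemma emeasure_edges_over:
  assumes "\<beta> > 0" "h > 0" "i \<noteq> j"
  shows "emeasure (lrp_edge_measure \<beta>) (edges_over h {i, j}) = lrp_mean \<beta> (unit_cube i) (unit_cube j)"
  using assms by (simp add: emeasure_edges_over_cubes lrp_mean_cube)

text \<open>Pairs of cells with infinite mean are joined outright: the discrete model contains the corresponding edges
with probability 1. With this choice the Poisson process is only ever examined on sets of finite measure.\<close>

definition coarse_graph :: "real \<Rightarrow> real \<Rightarrow> (real ^ 'n) set set \<Rightarrow> (int ^ 'n) set set" where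
  "coarse_graph \<beta> h E = near_pairs \<union>
     {e \<in> long_pairs. emeasure (lrp_edge_measure \<beta>) (edges_over h e) = \<infinity> \<or> E \<inter> edges_over h e \<noteq> {}}"

lemma norm1_gt_1_imp_neq: "norm1 (i - j) > 1 \<Longrightarrow> i \<noteq> j"
  using norm1_eq_0_iff[of "i - j"] by auto

lemma near_long_disjoint: "near_pairs \<inter> long_pairs = {}"
  unfolding near_pairs_def long_pairs_def by (auto simp: doubleton_eq_iff norm1_minus_commute)

text \<open>The sets of edges over distinct pairs of cells are disjoint, which gives independence; scale invariance gives
the probabilities, whatever the mesh.\<close>

lemma discrete_lrp_coarse_graph:
  fixes \<E> :: "'v \<Rightarrow> (real ^ 'n) set set"
  assumes "continuous_lrp M \<beta> \<E>" "\<beta> > 0" "h > 0"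
  shows "discrete_lrp M \<beta> (\<lambda>\<omega>. coarse_graph \<beta> h (\<E> \<omega>))"
proof -
  let ?\<mu> = "lrp_edge_measure \<beta> :: (real ^ 'n) set measure"
  interpret poisson_point_process M ?\<mu> \<E>
    using assms(1) by (simp add: continuous_lrp_def)
  let ?A = "\<lambda>e. {\<omega> \<in> space M. e \<in> coarse_graph \<beta> h (\<E> \<omega>)}"
  have sets: "edges_over h e \<in> sets ?\<mu>" if "e \<in> long_pairs" for e
    using that edges_over_sets by (auto simp: long_pairs_def)
  have fin: "?A e = at_least (edges_over h e) 1"
    if "e \<in> long_pairs" "emeasure ?\<mu> (edges_over h e) < \<infinity>" for e
    using that near_long_disjoint by (auto simp: coarse_graph_def at_least_def card_gt_0_iff)
  have inf: "?A e = space M" if "e \<in> long_pairs" "\<not> emeasure ?\<mu> (edges_over h e) < \<infinity>" for e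
    using that by (auto simp: coarse_graph_def less_top)
  have prob: "prob (?A {i, j}) = lrp_edge_prob \<beta> i j" if "norm1 (i - j) > 1" for i j
  proof -
    have e: "{i, j} \<in> long_pairs"
      using that by (auto simp: long_pairs_def)
    show ?thesis
    proof (cases "emeasure ?\<mu> (edges_over h {i, j}) < \<infinity>")
      case True
      have "measure ?\<mu> (edges_over h {i, j}) = enn2real (lrp_mean \<beta> (unit_cube i) (unit_cube j))"
        using emeasure_edges_over[OF assms(2,3) norm1_gt_1_imp_neq[OF that]] by (simp add: measure_def)
      then show ?thesis
        using True emeasure_edges_over[OF assms(2,3) norm1_gt_1_imp_neq[OF that]]
        unfolding fin[OF e True] prob_at_least[OF sets[OF e] True]
        by (simp add: lrp_edge_prob_def Let_def)
    next
      case False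
      then show ?thesis
        using inf[OF e] emeasure_edges_over[OF assms(2,3) norm1_gt_1_imp_neq[OF that]]
        by (simp add: lrp_edge_prob_def Let_def prob_space less_top[symmetric])
    qed
  qed
  have "indep_events ?A long_pairs"
    unfolding indep_events_def
  proof (intro conjI allI impI)
    show "?A ` long_pairs \<subseteq> events"
    proof clarify
      fix e :: "(int ^ 'n) set" assume "e \<in> long_pairs"
      then show "?A e \<in> events"
        using fin[of e] inf[of e] at_least_event[OF sets, of e 1]
        by (cases "emeasure ?\<mu> (edges_over h e) < \<infinity>") simp_all
    qed
    fix J :: "(int ^ 'n) set set" assume J: "J \<subseteq> long_pairs" "J \<noteq> {}" "finite J"
    define F where "F = {e \<in> J. emeasure ?\<mu> (edges_over h e) < \<infinity>}"
    have "(\<Inter>e\<in>J. ?A e) = {\<omega> \<in> space M. \<forall>e\<in>F. \<omega> \<in> at_least (edges_over h e) 1}"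
    proof -
      have "(\<Inter>e\<in>J. ?A e) = {\<omega> \<in> space M. \<forall>e\<in>J. \<omega> \<in> ?A e}"
        using \<open>J \<noteq> {}\<close> by auto
      also have "\<dots> = {\<omega> \<in> space M. \<forall>e\<in>F. \<omega> \<in> ?A e}"
        using J(1) inf unfolding F_def by blast
      also have "\<dots> = {\<omega> \<in> space M. \<forall>e\<in>F. \<omega> \<in> at_least (edges_over h e) 1}"
        using J(1) fin unfolding F_def by blast
      finally show ?thesis .
    qed
    also have "prob \<dots> = (\<Prod>e\<in>F. prob (at_least (edges_over h e) 1))"
      using J sets by (intro prob_all_at_least disjoint_edges_over) (auto simp: F_def)
    also have "\<dots> = (\<Prod>e\<in>F. prob (?A e))"
      using J(1) fin by (intro prod.cong) (auto simp: F_def)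
    also have "\<dots> = (\<Prod>e\<in>J. prob (?A e))"
      using J inf by (intro prod.mono_neutral_left) (auto simp: F_def prob_space subset_iff)
    finally show "prob (\<Inter>e\<in>J. ?A e) = (\<Prod>e\<in>J. prob (?A e))" .
  qed
  then have indep: "indep_events ?A {{i, j} | i j. norm1 (i - j) > 1}"
    by (simp add: long_pairs_def)
  have pairs: "near_pairs \<union> long_pairs \<subseteq> {{i, j :: int ^ 'n} | i j. i \<noteq> j}"
  proof
    fix e :: "(int ^ 'n) set" assume "e \<in> near_pairs \<union> long_pairs"
    then obtain i j where "e = {i, j}" "norm1 (i - j) \<ge> 1"
      by (auto simp: near_pairs_def long_pairs_def)
    moreover from this have "i \<noteq> j"
      using norm1_eq_0_iff[of "i - j"] by auto
    ultimately show "e \<in> {{i, j} | i j. i \<noteq> j}"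
      by blast
  qed
  show ?thesis
  proof (intro discrete_lrp.intro discrete_lrp_axioms.intro prob_space_axioms)
    show "coarse_graph \<beta> h (\<E> \<omega>) \<subseteq> {{i, j} | i j. i \<noteq> j}" for \<omega>
      using pairs by (auto simp: coarse_graph_def)
    show "{i, j} \<in> coarse_graph \<beta> h (\<E> \<omega>)" if "norm1 (i - j) = 1" for i j :: "int ^ 'n" and \<omega>
      using that by (auto simp: coarse_graph_def near_pairs_def)
  qed (use indep prob in simp_all)
qed

section \<open>Comparison of the two distances\<close>

lemma lattice_step_cases:
  fixes i j :: "int ^ 'n"
  assumes "{i, j} \<in> coarse_graph \<beta> h E" "\<beta> > 0" "h > 0"
  obtains "\<forall>k. \<bar>i $ k - j $ k\<bar> \<le> 1"
    | u v where "{u, v} \<in> E" "norm (u - v) > h" "cell h u = i" "cell h v = j"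
proof (cases "\<forall>k. \<bar>i $ k - j $ k\<bar> \<le> 1")
  case False
  then obtain k where "\<not> \<bar>i $ k - j $ k\<bar> \<le> 1"
    by blast
  then have k: "\<bar>i $ k - j $ k\<bar> \<ge> 2"
    by linarith
  have "\<bar>(i - j) $ k\<bar> \<le> norm1 (i - j)"
    unfolding norm1_def by (rule member_le_sum) auto
  then have "{i, j} \<notin> near_pairs"
    using k norm1_minus_commute[of i j] by (auto simp: near_pairs_def doubleton_eq_iff)
  moreover have "emeasure (lrp_edge_measure \<beta>) (edges_over h {i, j}) \<noteq> \<infinity>"
  proof -
    have "i \<noteq> j"
      using k by auto
    then show ?thesis
      using emeasure_edges_over[OF assms(2,3)] lrp_mean_unit_cubes_finite[OF assms(2) k]
      by (metis infinity_ennreal_def less_irrefl)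
  qed
  ultimately have "E \<inter> edges_over h {i, j} \<noteq> {}"
    using assms(1) by (auto simp: coarse_graph_def)
  then obtain u v where uv: "{u, v} \<in> E" "cell h u = i" "cell h v = j"
    by (auto simp: edges_over_pair)
  then have "norm (u - v) > h"
    using k by (intro norm_gt_of_cells_apart[OF assms(3), of u k v]) auto
  then show thesis
    using that(2) uv by blast
qed (rule that(1))

text \<open>A step of the coarse graph is imitated by going from the centre of a cell to the end of an edge, along the
edge at no cost, and on to the centre of the next cell. When the two cells touch, no edge is needed.\<close>

lemma continuous_path_of_graph_walk:
  fixes i j :: "int ^ 'n"
  assumes "(i, j) \<in> adj (coarse_graph \<beta> h E) ^^ m" "\<beta> > 0" "h > 0"
  shows "\<exists>es. admissible h E es \<and>
    path_cost (h *\<^sub>R lattice_point i) es (h *\<^sub>R lattice_point j) \<le> real CARD('n) * h * real m"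
  using assms(1)
proof (induction m arbitrary: j)
  case 0
  then show ?case
    by (intro exI[of _ "[]"]) (simp add: admissible_def)
next
  case (Suc m)
  then obtain k where k: "(i, k) \<in> adj (coarse_graph \<beta> h E) ^^ m" "{k, j} \<in> coarse_graph \<beta> h E"
    by auto
  let ?c = "\<lambda>i :: int ^ 'n. h *\<^sub>R lattice_point i :: real ^ 'n"
  obtain es where es: "admissible h E es" "path_cost (?c i) es (?c k) \<le> real CARD('n) * h * real m"
    using Suc.IH k(1) by blast
  have "\<exists>fs. admissible h E fs \<and> path_cost (?c k) fs (?c j) \<le> real CARD('n) * h"
    using k(2) assms(2,3)
  proof (cases rule: lattice_step_cases)
    case 1
    have "norm (?c k - ?c j) \<le> (\<Sum>l\<in>UNIV. \<bar>(?c k - ?c j) $ l\<bar>)"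
      by (rule norm_le_l1_cart)
    also have "\<dots> \<le> (\<Sum>l\<in>(UNIV :: 'n set). h)"
    proof (intro sum_mono)
      fix l :: 'n
      have "\<bar>(?c k - ?c j) $ l\<bar> = h * real_of_int \<bar>k $ l - j $ l\<bar>"
        using assms(3) by (simp add: lattice_point_def right_diff_distrib[symmetric] abs_mult)
      also have "\<dots> \<le> h * 1"
        using 1 assms(3) by (intro mult_left_mono) (auto simp flip: of_int_diff of_int_abs)
      finally show "\<bar>(?c k - ?c j) $ l\<bar> \<le> h" by simp
    qed
    finally show ?thesis
      by (intro exI[of _ "[]"]) (simp add: admissible_def)
  next
    case (2 u v)
    then show ?thesis
      using norm_centre_le[OF assms(3), of u] norm_centre_le[OF assms(3), of v]
      by (intro exI[of _ "[(u, v)]"]) (simp add: admissible_def norm_minus_commute)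
  qed
  then obtain fs where fs: "admissible h E fs" "path_cost (?c k) fs (?c j) \<le> real CARD('n) * h"
    by blast
  have "path_cost (?c i) (es @ fs) (?c j) \<le> real CARD('n) * h * real (Suc m)"
    using path_cost_append_le[of "?c i" es fs "?c j" "?c k"] es(2) fs(2) by (simp add: algebra_simps)
  then show ?case
    using es(1) fs(1) by (intro exI[of _ "es @ fs"]) (auto simp: admissible_def)
qed

lemma lrp_dist_le_graph_dist:
  fixes i j :: "int ^ 'n"
  assumes "\<beta> > 0" "h > 0"
  shows "lrp_dist h E (h *\<^sub>R lattice_point i) (h *\<^sub>R lattice_point j)
    \<le> real CARD('n) * h * real (graph_dist (coarse_graph \<beta> h E) i j)"
proof -
  have "(i, j) \<in> adj (coarse_graph \<beta> h E) ^^ nat (norm1 (i - j))"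
    by (rule lattice_walk) (simp add: coarse_graph_def)
  then show ?thesis
    using continuous_path_of_graph_walk[OF graph_dist_attained assms] lrp_dist_le order.trans
    by blast
qed

text \<open>Each of the \<^term>\<open>length es + 1\<close> walks may cross a cell boundary however short it is; this is
the origin of the terms in \<^term>\<open>length es\<close>, which have to be controlled separately.\<close>

lemma graph_walk_of_continuous_path:
  fixes x y :: "real ^ 'n"
  assumes "admissible h E es" "h > 0"
  shows "\<exists>m. (cell h x, cell h y) \<in> adj (coarse_graph \<beta> h E) ^^ m \<and>
    real m \<le> real CARD('n) * (path_cost x es y / h) + real CARD('n) * (real (length es) + 1) + real (length es)"
  using assms(1)
proof (induction x es y rule: path_cost.induct)
  case (1 x y)
  have "(cell h x, cell h y) \<in> adj (coarse_graph \<beta> h E) ^^ nat (norm1 (cell h x - cell h y))"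
    by (rule lattice_walk) (simp add: coarse_graph_def)
  moreover have "real (nat (norm1 (cell h x - cell h y))) \<le> real CARD('n) * (norm (x - y) / h + 1)"
    using norm1_cell_diff_le[OF assms(2), of x y] norm1_nonneg[of "cell h x - cell h y"] by simp
  ultimately show ?case
    by (intro exI[of _ "nat (norm1 (cell h x - cell h y))"]) (simp add: algebra_simps)
next
  case (2 x u v es y)
  let ?R = "adj (coarse_graph \<beta> h E)" and ?d = "real CARD('n)"
  let ?m = "nat (norm1 (cell h x - cell h u))"
  have m: "(cell h x, cell h u) \<in> ?R ^^ ?m" "real ?m \<le> ?d * (norm (x - u) / h + 1)"
  proof -
    show "(cell h x, cell h u) \<in> ?R ^^ ?m"
      by (rule lattice_walk) (simp add: coarse_graph_def)
    show "real ?m \<le> ?d * (norm (x - u) / h + 1)"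
      using norm1_cell_diff_le[OF assms(2), of x u] norm1_nonneg[of "cell h x - cell h u"] by simp
  qed
  obtain m' where m': "(cell h v, cell h y) \<in> ?R ^^ m'"
    "real m' \<le> ?d * (path_cost v es y / h) + ?d * (real (length es) + 1) + real (length es)"
    using 2 by (auto simp: admissible_def)
  have "\<exists>l. (cell h u, cell h v) \<in> ?R ^^ l \<and> l \<le> 1"
  proof (cases "cell h u = cell h v")
    case True
    then show ?thesis
      by (intro exI[of _ 0]) simp
  next
    case False
    have "{u, v} \<in> E"
      using 2(2) by (simp add: admissible_def)
    have "norm1 (cell h u - cell h v) = 1 \<or> norm1 (cell h u - cell h v) > 1"
      using False norm1_nonneg[of "cell h u - cell h v"] norm1_eq_0_iff[of "cell h u - cell h v"] by fastforce
    then have "{cell h u, cell h v} \<in> coarse_graph \<beta> h E"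
    proof
      assume "norm1 (cell h u - cell h v) = 1"
      then show ?thesis
        unfolding coarse_graph_def near_pairs_def by blast
    next
      assume "norm1 (cell h u - cell h v) > 1"
      then have "{cell h u, cell h v} \<in> long_pairs"
        unfolding long_pairs_def by blast
      moreover have "{u, v} \<in> E \<inter> edges_over h {cell h u, cell h v}"
        using \<open>{u, v} \<in> E\<close> by (simp add: doubleton_in_edges_over)
      ultimately show ?thesis
        unfolding coarse_graph_def by blast
    qed
    then show ?thesis
      by (intro exI[of _ 1]) simp
  qed
  then obtain l where l: "(cell h u, cell h v) \<in> ?R ^^ l" "l \<le> 1"
    by blast
  have "(cell h x, cell h y) \<in> ?R ^^ (?m + l + m')"
    using m(1) l(1) m'(1) by (auto simp: relpow_add)
  moreover have "real (?m + l + m') \<le> ?d * (path_cost x ((u, v) # es) y / h)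
      + ?d * (real (length ((u, v) # es)) + 1) + real (length ((u, v) # es))"
    using m(2) l(2) m'(2) by (simp add: algebra_simps add_divide_distrib)
  ultimately show ?case
    by blast
qed

section \<open>Expected number of long edges from a cell\<close>

text \<open>The volume of a ball enters through the dyadic shells below; the factor \<open>2 ^ (d + 1)\<close> is
\<open>2 ^ d\<close> from the outer radius of a shell times 2 from the geometric series over the shells.\<close>

definition tail_const :: "'n itself \<Rightarrow> real" where
  "tail_const _ = 2 ^ (CARD('n) + 1) * unit_ball_vol (real CARD('n))"

lemma dyadic_scale:
  fixes r t :: real
  assumes "r > 0" "t \<ge> r"
  obtains k :: nat where "2 ^ k * r \<le> t" "t < 2 ^ Suc k * r"
proof -
  obtain m :: nat where "t / r < 2 ^ m"
    using real_arch_pow[of 2 "t / r"] by auto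
  then have ex: "t < 2 ^ m * r"
    using assms by (simp add: field_simps)
  define m' where "m' = (LEAST m. t < 2 ^ m * r)"
  have m': "t < 2 ^ m' * r"
    unfolding m'_def using ex by (rule LeastI)
  then obtain k where k: "m' = Suc k"
    using assms by (cases m') auto
  then have "\<not> t < 2 ^ k * r"
    unfolding m'_def using not_less_Least[of k "\<lambda>m. t < 2 ^ m * r"] by auto
  then show thesis
    using that[of k] m' k by auto
qed

text \<open>On the shell where the distance is between \<open>2 ^ k r\<close> and \<open>2 ^ (k + 1) r\<close> the
intensity is at most \<open>\<beta> (2 ^ k r) ^ (- 2 d)\<close>, and the volume of the enclosing ball is of
order \<open>(2 ^ k r) ^ d\<close>. The products decay geometrically in \<open>k\<close>.\<close>

lemma lrp_intensity_tail:
  fixes x :: "real ^ 'n"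
  assumes "\<beta> > 0" "r > 0"
  shows "(\<integral>\<^sup>+y\<in>{y. norm (x - y) \<ge> r}. lrp_intensity \<beta> x y \<partial>lborel)
    \<le> ennreal (\<beta> * tail_const TYPE('n) / r ^ CARD('n))"
proof -
  let ?d = "CARD('n)" and ?V = "unit_ball_vol (real CARD('n))"
  let ?c = "\<lambda>k :: nat. \<beta> / (2 ^ k * r) ^ (2 * ?d)"
  let ?f = "\<lambda>k y. ennreal (?c k) * indicator (ball x (2 ^ Suc k * r)) y"
  have "lrp_intensity \<beta> x y * indicator {y. norm (x - y) \<ge> r} y \<le> (\<Sum>k. ?f k y)" for y
  proof (cases "norm (x - y) \<ge> r")
    case True
    then obtain k where k: "2 ^ k * r \<le> norm (x - y)" "norm (x - y) < 2 ^ Suc k * r"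
      using dyadic_scale[OF assms(2)] by blast
    have "\<beta> / norm (x - y) ^ (2 * ?d) \<le> ?c k"
    proof (intro divide_left_mono power_mono mult_pos_pos zero_less_power)
      have "0 < 2 ^ k * r"
        using assms by simp
      then show "0 < norm (x - y)"
        using k(1) by linarith
    qed (use k(1) assms in auto)
    then have "lrp_intensity \<beta> x y * indicator {y. norm (x - y) \<ge> r} y \<le> ?f k y"
      using True k(2) by (simp add: lrp_intensity_def ennreal_leI dist_norm)
    also have "\<dots> = (\<Sum>j\<in>{k}. ?f j y)"
      by (subst sum.insert) simp_all
    also have "\<dots> \<le> (\<Sum>j. ?f j y)"
      by (rule sum_le_suminf) auto
    finally show ?thesis .
  qed simp
  then have "(\<integral>\<^sup>+y\<in>{y. norm (x - y) \<ge> r}. lrp_intensity \<beta> x y \<partial>lborel) \<le> (\<integral>\<^sup>+y. (\<Sum>k. ?f k y) \<partial>lborel)"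
    by (rule nn_integral_mono)
  also have "\<dots> = (\<Sum>k. \<integral>\<^sup>+y. ?f k y \<partial>lborel)"
  proof (rule nn_integral_suminf)
    have "ball x c \<in> sets lborel" for c
      by simp
    then show "?f k \<in> borel_measurable lborel" for k
      by (intro borel_measurable_times_ennreal borel_measurable_const borel_measurable_indicator)
  qed
  also have "\<dots> = (\<Sum>k. ennreal (?c k * (?V * (2 ^ Suc k * r) ^ ?d)))"
  proof (intro arg_cong[where f=suminf] ext)
    fix k
    have "(\<integral>\<^sup>+y. ?f k y \<partial>lborel) = ennreal (?c k) * emeasure lborel (ball x (2 ^ Suc k * r))"
      by (rule nn_integral_cmult_indicator) simp
    also have "emeasure lborel (ball x (2 ^ Suc k * r)) = ennreal (?V * (2 ^ Suc k * r) ^ ?d)"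
      using assms by (subst emeasure_ball) simp_all
    finally show "(\<integral>\<^sup>+y. ?f k y \<partial>lborel) = ennreal (?c k * (?V * (2 ^ Suc k * r) ^ ?d))"
      using assms by (simp only: ennreal_mult'[symmetric]) (simp add: ennreal_mult''[symmetric])
  qed
  also have "\<dots> \<le> (\<Sum>k. ennreal (\<beta> * ?V * 2 ^ ?d / r ^ ?d * (1 / 2) ^ k))"
  proof (intro suminf_le summableI ennreal_leI)
    fix k :: nat
    have "?c k * (?V * (2 ^ Suc k * r) ^ ?d) = \<beta> * ?V * 2 ^ ?d / r ^ ?d * (1 / 2) ^ (k * ?d)"
    proof -
      define a R where "a = (2 ^ k :: real) ^ ?d" and "R = r ^ ?d"
      have pos: "a > 0" "R > 0"
        using assms(2) by (simp_all add: a_def R_def)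
      have "(2 ^ k * r) ^ (2 * ?d) = (a * R) ^ 2"
        by (simp add: a_def R_def power_mult_distrib power_mult[symmetric] mult.commute mult.left_commute)
      moreover have "(2 ^ Suc k * r) ^ ?d = 2 ^ ?d * a * R"
        by (simp add: a_def R_def power_mult_distrib)
      moreover have "(1 / 2 :: real) ^ (k * ?d) = 1 / a"
        by (simp add: a_def power_one_over power_mult)
      moreover have "\<beta> / (a * R) ^ 2 * (?V * (2 ^ ?d * a * R)) = \<beta> * ?V * 2 ^ ?d / R * (1 / a)"
        using pos by (simp add: power2_eq_square field_simps)
      ultimately show ?thesis
        by (simp add: R_def)
    qed
    also have "\<dots> \<le> \<beta> * ?V * 2 ^ ?d / r ^ ?d * (1 / 2) ^ k"
      using assms by (intro mult_left_mono power_decreasing) auto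
    finally show "?c k * (?V * (2 ^ Suc k * r) ^ ?d) \<le> \<beta> * ?V * 2 ^ ?d / r ^ ?d * (1 / 2) ^ k" .
  qed
  also have "\<dots> = ennreal (\<beta> * ?V * 2 ^ ?d / r ^ ?d * 2)"
  proof -
    have "(\<lambda>k. c * (1 / 2) ^ k) sums (c * 2)" for c :: real
      using sums_mult[OF geometric_sums[of "1 / 2 :: real"]] by simp
    from this[of "\<beta> * ?V * 2 ^ ?d / r ^ ?d"] show ?thesis
      by (rule suminf_ennreal_eq[rotated]) (use assms in simp)
  qed
  also have "\<beta> * ?V * 2 ^ ?d / r ^ ?d * 2 = \<beta> * tail_const TYPE('n) / r ^ ?d"
    by (simp add: tail_const_def)
  finally show ?thesis .
qed

definition far :: "real \<Rightarrow> real \<Rightarrow> int ^ 'n \<Rightarrow> int ^ 'n \<Rightarrow> bool" where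
  "far h r i j \<longleftrightarrow> (\<forall>x\<in>cube h i. \<forall>y\<in>cube h j. norm (x - y) \<ge> r)"

definition far_mean :: "real \<Rightarrow> real \<Rightarrow> real \<Rightarrow> int ^ 'n \<Rightarrow> int ^ 'n \<Rightarrow> ennreal" where
  "far_mean \<beta> h r i j = (if far h r i j then emeasure (lrp_edge_measure \<beta>) (edges_over h {i, j}) else 0)"

lemma far_imp_neq:
  assumes "far h r i j" "h > 0" "r > 0"
  shows "i \<noteq> j"
proof
  assume "i = j"
  moreover have "h *\<^sub>R lattice_point i \<in> cube h i"
    using cell_centre[OF assms(2)] by simp
  ultimately have "norm (h *\<^sub>R lattice_point i - h *\<^sub>R lattice_point i) \<ge> r"
    using assms(1) unfolding far_def by blast
  then show False
    using assms(3) by simp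
qed

text \<open>Only the cells at distance at least \<open>r\<close> contribute, so the sum over \<open>j\<close> is bounded
by the integral over the starting point of the tail of the intensity. With \<open>r\<close> fixed the bound is
proportional to the volume of the cell; this smallness is what makes cheap paths unlikely.\<close>

lemma nn_integral_far_mean_le:
  fixes i :: "int ^ 'n"
  assumes "\<beta> > 0" "h > 0" "r > 0"
  shows "(\<integral>\<^sup>+j. far_mean \<beta> h r i j \<partial>count_space UNIV)
    \<le> ennreal (h ^ CARD('n) * (\<beta> * tail_const TYPE('n) / r ^ CARD('n)))"
proof -
  let ?K = "\<lambda>x y :: real ^ 'n. lrp_intensity \<beta> x y * indicator {y. norm (x - y) \<ge> r} y"
  have [measurable]: "(\<lambda>p. ?K (fst p) (snd p)) \<in> borel_measurable (borel \<Otimes>\<^sub>M borel)"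
  proof -
    have "(\<lambda>p. ?K (fst p) (snd p)) = (\<lambda>p. lrp_intensity \<beta> (fst p) (snd p) *
        indicator {r..} (norm (fst p - snd p)))"
      by (auto simp: indicator_def)
    also have "\<dots> \<in> borel_measurable (borel \<Otimes>\<^sub>M borel)"
      by measurable
    finally show ?thesis .
  qed
  have Kx [measurable]: "?K x \<in> borel_measurable borel" for x
    using measurable_compose[OF measurable_Pair1'[of x borel borel] \<open>(\<lambda>p. ?K (fst p) (snd p)) \<in> _\<close>] by simp
  let ?g = "\<lambda>j x. (\<integral>\<^sup>+y\<in>cube h j. ?K x y \<partial>lborel)"
  have g [measurable]: "?g j \<in> borel_measurable borel" for j
    by (intro lborel.borel_measurable_nn_integral) measurable
  have "far_mean \<beta> h r i j \<le> (\<integral>\<^sup>+x\<in>cube h i. ?g j x \<partial>lborel)" for j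
  proof (cases "far h r i j")
    case True
    have "far_mean \<beta> h r i j = lrp_mean \<beta> (cube h i) (cube h j)"
      using True far_imp_neq[OF True assms(2,3)] assms by (simp add: far_mean_def emeasure_edges_over_cubes)
    also have "\<dots> \<le> (\<integral>\<^sup>+x\<in>cube h i. ?g j x \<partial>lborel)"
      unfolding lrp_mean_def using True
      by (intro nn_integral_mono) (auto intro!: nn_integral_mono simp: far_def split: split_indicator)
    finally show ?thesis .
  qed (simp add: far_mean_def)
  then have "(\<integral>\<^sup>+j. far_mean \<beta> h r i j \<partial>count_space UNIV)
      \<le> (\<integral>\<^sup>+j. (\<integral>\<^sup>+x\<in>cube h i. ?g j x \<partial>lborel) \<partial>count_space UNIV)"
    by (intro nn_integral_mono)
  also have "\<dots> = (\<integral>\<^sup>+x. (\<integral>\<^sup>+j. ?g j x * indicator (cube h i) x \<partial>count_space UNIV) \<partial>lborel)"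
    by (rule nn_integral_count_space_nn_integral[symmetric]) auto
  also have "\<dots> \<le> (\<integral>\<^sup>+x. ennreal (\<beta> * tail_const TYPE('n) / r ^ CARD('n)) * indicator (cube h i) x \<partial>lborel)"
  proof (intro nn_integral_mono)
    fix x :: "real ^ 'n"
    have "(\<integral>\<^sup>+j. ?g j x * indicator (cube h i) x \<partial>count_space UNIV)
        = (\<integral>\<^sup>+j. ?g j x \<partial>count_space UNIV) * indicator (cube h i) x"
      by (rule nn_integral_multc) auto
    also have "(\<integral>\<^sup>+j. ?g j x \<partial>count_space UNIV)
        = (\<integral>\<^sup>+y. (\<integral>\<^sup>+j. ?K x y * indicator (cube h j) y \<partial>count_space UNIV) \<partial>lborel)"
      by (rule nn_integral_count_space_nn_integral[symmetric]) auto
    also have "\<dots> = (\<integral>\<^sup>+y. ?K x y \<partial>lborel)"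
    proof (intro nn_integral_cong)
      fix y :: "real ^ 'n"
      have "(\<integral>\<^sup>+j. ?K x y * indicator (cube h j) y \<partial>count_space UNIV)
          = (\<integral>\<^sup>+j. ?K x y * indicator {cell h y} j \<partial>count_space UNIV)"
        by (intro nn_integral_cong) (auto simp: indicator_def)
      then show "(\<integral>\<^sup>+j. ?K x y * indicator (cube h j) y \<partial>count_space UNIV) = ?K x y"
        by (simp add: nn_integral_cmult)
    qed
    also have "\<dots> \<le> ennreal (\<beta> * tail_const TYPE('n) / r ^ CARD('n))"
      using lrp_intensity_tail[OF assms(1,3)] .
    finally show "(\<integral>\<^sup>+j. ?g j x * indicator (cube h i) x \<partial>count_space UNIV)
        \<le> ennreal (\<beta> * tail_const TYPE('n) / r ^ CARD('n)) * indicator (cube h i) x"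
      by (auto split: split_indicator)
  qed
  also have "\<dots> = ennreal (\<beta> * tail_const TYPE('n) / r ^ CARD('n)) * ennreal (h ^ CARD('n))"
    by (subst nn_integral_cmult_indicator) (auto simp: emeasure_cube[OF assms(2)])
  also have "\<dots> = ennreal (h ^ CARD('n) * (\<beta> * tail_const TYPE('n) / r ^ CARD('n)))"
    using assms by (simp add: ennreal_mult[symmetric] tail_const_def mult.commute)
  finally show ?thesis .
qed

section \<open>Weights of cell paths\<close>

text \<open>A path is given by alternating displacements: walks between cells, and edges. The walks are weighted with the
mass function of a probability distribution on the lattice, so that they can be summed over at no cost; its
exponentially decreasing tail keeps the weight of a path bounded below in terms of its total walking length.\<close>

definition int_pmf :: "int pmf" where
  "int_pmf = map_pmf int_decode (geometric_pmf (1 / 2))"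

lemma pmf_int_ge: "pmf int_pmf k \<ge> (1 / 4) ^ (nat \<bar>k\<bar> + 1)"
proof -
  have "pmf int_pmf k = pmf (geometric_pmf (1 / 2)) (int_encode k)"
    using pmf_map_inj'[OF inj_int_decode, of "geometric_pmf (1 / 2)" "int_encode k"]
    by (simp add: int_pmf_def)
  also have "\<dots> = (1 / 2) ^ (int_encode k + 1)"
    by simp
  also have "\<dots> \<ge> (1 / 2) ^ (2 * (nat \<bar>k\<bar> + 1))"
    by (intro power_decreasing) (auto simp: int_encode_def sum_encode_def)
  also have "(1 / 2 :: real) ^ (2 * (nat \<bar>k\<bar> + 1)) = (1 / 4) ^ (nat \<bar>k\<bar> + 1)"
    by (simp only: power_mult) (simp add: power2_eq_square)
  finally show ?thesis .
qed

definition jump_pmf :: "(int ^ 'n) pmf" where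
  "jump_pmf = map_pmf vec_lambda (Pi_pmf UNIV 0 (\<lambda>_. int_pmf))"

lemma pmf_jump_ge:
  fixes z :: "int ^ 'n"
  shows "pmf jump_pmf z \<ge> (1 / 4) ^ (nat (norm1 z) + CARD('n))"
proof -
  have "inj (vec_lambda :: ('n \<Rightarrow> int) \<Rightarrow> _)"
    by (rule injI) (metis vec_lambda_inverse UNIV_I)
  from pmf_map_inj'[OF this, of "Pi_pmf UNIV 0 (\<lambda>_. int_pmf)" "\<lambda>k. z $ k"]
  have "pmf jump_pmf z = (\<Prod>k\<in>UNIV. pmf int_pmf (z $ k))"
    by (simp add: jump_pmf_def pmf_Pi)
  also have "\<dots> \<ge> (\<Prod>k\<in>(UNIV :: 'n set). (1 / 4) ^ (nat \<bar>z $ k\<bar> + 1))"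
    using pmf_int_ge by (intro prod_mono conjI) simp_all
  also have "(\<Prod>k\<in>(UNIV :: 'n set). (1 / 4 :: real) ^ (nat \<bar>z $ k\<bar> + 1)) = (1 / 4) ^ (\<Sum>k\<in>UNIV. nat \<bar>z $ k\<bar> + 1)"
    by (rule power_sum[symmetric])
  also have "(\<Sum>k\<in>(UNIV :: 'n set). nat \<bar>z $ k\<bar> + 1) = nat (norm1 z) + CARD('n)"
  proof -
    have "int (\<Sum>k\<in>(UNIV :: 'n set). nat \<bar>z $ k\<bar> + 1) = norm1 z + int CARD('n)"
      by (simp add: norm1_def sum.distrib)
    then show ?thesis
      using norm1_nonneg[of z] by linarith
  qed
  finally show ?thesis .
qed

text \<open>A path is encoded by the pairs of cells over which its edges lie; \<open>c\<close> is the cell where it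
starts.\<close>

fun path_weight :: "(int ^ 'n \<Rightarrow> int ^ 'n \<Rightarrow> ennreal) \<Rightarrow> int ^ 'n \<Rightarrow> ((int ^ 'n) \<times> (int ^ 'n)) list \<Rightarrow> ennreal" where
  "path_weight p c [] = 1"
| "path_weight p c ((i, j) # es) = ennreal (pmf jump_pmf (i - c)) * p i j * path_weight p j es"

text \<open>Summing over the last edge first, each edge contributes at most a factor \<open>q\<close> and each walk the
total mass 1.\<close>

lemma sum_path_weight_le:
  fixes p :: "int ^ 'n \<Rightarrow> int ^ 'n \<Rightarrow> ennreal"
  assumes p: "\<And>i. (\<integral>\<^sup>+j. p i j \<partial>count_space UNIV) \<le> q"
  shows "(\<integral>\<^sup>+es. path_weight p c es * indicator {es. length es = m} es \<partial>count_space UNIV) \<le> q ^ m"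
proof (induction m arbitrary: c)
  case 0
  have "(\<integral>\<^sup>+es. path_weight p c es * indicator {es. length es = 0} es \<partial>count_space UNIV)
      = (\<integral>\<^sup>+es. 1 * indicator {[] :: ((int ^ 'n) \<times> (int ^ 'n)) list} es \<partial>count_space UNIV)"
    by (intro nn_integral_cong) (auto split: split_indicator)
  then show ?case
    by simp
next
  case (Suc m)
  let ?L = "\<lambda>m. indicator {es :: ((int ^ 'n) \<times> (int ^ 'n)) list. length es = m} :: _ \<Rightarrow> ennreal"
  let ?f = "\<lambda>es. path_weight p c es * ?L (Suc m) es"
  let ?w = "\<lambda>i. ennreal (pmf jump_pmf (i - c))"
  have "(\<integral>\<^sup>+es. ?f es \<partial>count_space UNIV) = (\<integral>\<^sup>+es. ?f es \<partial>count_space {es. es \<noteq> []})"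
    by (subst nn_integral_count_space_indicator) (auto intro!: nn_integral_cong split: split_indicator)
  also have "\<dots> = (\<integral>\<^sup>+x. ?f (fst x # snd x) \<partial>count_space UNIV)"
    by (rule nn_integral_bij_count_space[symmetric])
      (auto simp: bij_betw_def inj_on_def image_iff neq_Nil_conv)
  also have "\<dots> = (\<integral>\<^sup>+e. (\<integral>\<^sup>+es. ?f (e # es) \<partial>count_space UNIV) \<partial>count_space UNIV)"
    by (subst nn_integral_fst_count_space[symmetric]) simp
  also have "\<dots> = (\<integral>\<^sup>+i. (\<integral>\<^sup>+j. (\<integral>\<^sup>+es. ?f ((i, j) # es) \<partial>count_space UNIV) \<partial>count_space UNIV) \<partial>count_space UNIV)"
    by (rule nn_integral_fst_count_space[symmetric])
  also have "\<dots> = (\<integral>\<^sup>+i. (\<integral>\<^sup>+j. ?w i * p i j *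
      (\<integral>\<^sup>+es. path_weight p j es * ?L m es \<partial>count_space UNIV) \<partial>count_space UNIV) \<partial>count_space UNIV)"
    by (subst nn_integral_cmult[symmetric])
      (auto intro!: nn_integral_cong simp: mult.assoc split: split_indicator)
  also have "\<dots> \<le> (\<integral>\<^sup>+i. (\<integral>\<^sup>+j. ?w i * p i j * q ^ m \<partial>count_space UNIV) \<partial>count_space UNIV)"
    by (intro nn_integral_mono mult_left_mono Suc.IH) simp
  also have "\<dots> = (\<integral>\<^sup>+i. ?w i * (\<integral>\<^sup>+j. p i j \<partial>count_space UNIV) * q ^ m \<partial>count_space UNIV)"
    by (simp add: nn_integral_multc nn_integral_cmult)
  also have "\<dots> \<le> (\<integral>\<^sup>+i. ?w i * q * q ^ m \<partial>count_space UNIV)"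
    by (intro nn_integral_mono mult_right_mono mult_left_mono p) simp_all
  also have "\<dots> = (\<integral>\<^sup>+i. ?w i \<partial>count_space UNIV) * q ^ Suc m"
    by (simp add: mult.assoc nn_integral_multc)
  also have "(\<integral>\<^sup>+i. ?w i \<partial>count_space UNIV) = (\<integral>\<^sup>+i. ennreal (pmf (jump_pmf :: (int ^ 'n) pmf) i) \<partial>count_space UNIV)"
    by (rule nn_integral_bij_count_space[where g="\<lambda>i. i - c" and f="\<lambda>i. ennreal (pmf jump_pmf i)"])
      (rule bij_betw_byWitness[where f'="\<lambda>i. i + c"], auto)
  also have "\<dots> = 1"
    by (simp add: nn_integral_pmf)
  finally show ?case
    by simp
qed

text \<open>The final walk, from the last edge to the target, is left out: only walks that lead to an edge restrict the
choice of edges.\<close>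

fun jump_length :: "int ^ 'n \<Rightarrow> ((int ^ 'n) \<times> (int ^ 'n)) list \<Rightarrow> nat" where
  "jump_length c [] = 0"
| "jump_length c ((i, j) # es) = nat (norm1 (i - c)) + jump_length j es"

text \<open>The factor is what is lost when the mass of each walk is replaced by its lower bound.\<close>

lemma prod_list_le_path_weight:
  fixes p :: "int ^ 'n \<Rightarrow> int ^ 'n \<Rightarrow> ennreal"
  shows "prod_list (map (\<lambda>(i, j). p i j) es)
    \<le> ennreal (4 ^ (jump_length c es + CARD('n) * length es)) * path_weight p c es"
proof (induction es arbitrary: c)
  case (Cons e es)
  obtain i j where e: "e = (i, j)"
    by (cases e)
  let ?k = "nat (norm1 (i - c)) + CARD('n)" and ?l = "jump_length j es + CARD('n) * length es"
  have "1 = 4 ^ ?k * (1 / 4 :: real) ^ ?k"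
    by (simp flip: power_mult_distrib)
  also have "\<dots> \<le> 4 ^ ?k * pmf jump_pmf (i - c)"
    by (intro mult_left_mono pmf_jump_ge) simp
  finally have one: "1 \<le> ennreal (4 ^ ?k) * ennreal (pmf jump_pmf (i - c))"
    by (simp flip: ennreal_mult)
  have "prod_list (map (\<lambda>(i, j). p i j) (e # es)) \<le> p i j * (ennreal (4 ^ ?l) * path_weight p j es)"
    unfolding e using Cons[of j] by (simp add: mult_left_mono)
  also have "\<dots> \<le> (ennreal (4 ^ ?k) * ennreal (pmf jump_pmf (i - c))) * (p i j * (ennreal (4 ^ ?l) * path_weight p j es))"
    using mult_right_mono[OF one, of "p i j * (ennreal (4 ^ ?l) * path_weight p j es)"] by simp
  also have "\<dots> = (ennreal (4 ^ ?k) * ennreal (4 ^ ?l)) * path_weight p c (e # es)"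
    unfolding e by (simp add: ac_simps)
  also have "ennreal (4 ^ ?k) * ennreal (4 ^ ?l) = ennreal (4 ^ (?k + ?l))"
    by (simp add: ennreal_mult[symmetric] power_add)
  also have "?k + ?l = jump_length c (e # es) + CARD('n) * length (e # es)"
    by (simp add: e)
  finally show ?case .
qed simp

section \<open>Cheap paths with many edges are unlikely\<close>

lemma emeasure_UN_le_nn_integral:
  assumes "countable I" and [measurable]: "\<And>i. i \<in> I \<Longrightarrow> A i \<in> sets M"
  shows "emeasure M (\<Union>i\<in>I. A i) \<le> (\<integral>\<^sup>+i. emeasure M (A i) \<partial>count_space I)"
proof -
  have U: "(\<Union>i\<in>I. A i) \<in> sets M"
    using assms by (intro sets.countable_UN') auto
  have "emeasure M (\<Union>i\<in>I. A i) = (\<integral>\<^sup>+x. indicator (\<Union>i\<in>I. A i) x \<partial>M)"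
    using U by simp
  also have "\<dots> \<le> (\<integral>\<^sup>+x. (\<integral>\<^sup>+i. indicator (A i) x \<partial>count_space I) \<partial>M)"
  proof (intro nn_integral_mono)
    fix x
    show "indicator (\<Union>i\<in>I. A i) x \<le> (\<integral>\<^sup>+i. indicator (A i) x \<partial>count_space I :: ennreal)"
    proof (cases "x \<in> (\<Union>i\<in>I. A i)")
      case True
      then obtain i where i: "i \<in> I" "x \<in> A i"
        by blast
      then have "1 = (\<integral>\<^sup>+j. indicator {i} j \<partial>count_space I :: ennreal)"
        by simp
      also have "\<dots> \<le> (\<integral>\<^sup>+j. indicator (A j) x \<partial>count_space I)"
        using i by (intro nn_integral_mono) (auto split: split_indicator)
      finally show ?thesis
        using True by simp
    qed simp
  qed
  also have "\<dots> = (\<integral>\<^sup>+i. (\<integral>\<^sup>+x. indicator (A i) x \<partial>M) \<partial>count_space I)"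
    using assms by (intro nn_integral_count_space_nn_integral) auto
  also have "\<dots> = (\<integral>\<^sup>+i. emeasure M (A i) \<partial>count_space I)"
    using assms by (intro nn_integral_cong) simp
  finally show ?thesis .
qed

lemma prod_power_count_list:
  fixes f :: "'a \<Rightarrow> 'b :: comm_monoid_mult"
  assumes "finite S" "set xs \<subseteq> S"
  shows "(\<Prod>x\<in>S. f x ^ count_list xs x) = prod_list (map f xs)"
  using assms(2)
proof (induction xs)
  case (Cons a xs)
  have "(\<Prod>x\<in>S. f x ^ count_list (a # xs) x) = (\<Prod>x\<in>S. (if x = a then f a else 1) * f x ^ count_list xs x)"
    by (intro prod.cong) auto
  also have "\<dots> = f a * prod_list (map f xs)"
    using Cons assms(1) by (simp add: prod.distrib)
  finally show ?case
    by simp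
qed simp

definition far_path :: "real \<Rightarrow> real \<Rightarrow> ((int ^ 'n) \<times> (int ^ 'n)) list \<Rightarrow> bool" where
  "far_path h r es \<longleftrightarrow> (\<forall>(i, j)\<in>set es. far h r i j)"

locale poisson_lrp = poisson_point_process M "lrp_edge_measure \<beta>" \<E>
  for M :: "'v measure" and \<beta> :: real and \<E> :: "'v \<Rightarrow> (real ^ 'n) set set" +
  assumes beta_pos: "\<beta> > 0"
begin

text \<open>The edges of a path are distinct, but several of them may lie over the same pair of cells; that pair must then
carry that many edges.\<close>

definition occupied :: "real \<Rightarrow> ((int ^ 'n) \<times> (int ^ 'n)) list \<Rightarrow> 'v set" where
  "occupied h es = {\<omega> \<in> space M. \<forall>e\<in>undirected ` set es.
     \<omega> \<in> at_least (edges_over h e) (count_list (map undirected es) e)}"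

lemma emeasure_edges_over_far:
  fixes i j :: "int ^ 'n"
  assumes "far h r i j" "h > 0" "r > 0"
  shows "emeasure (lrp_edge_measure \<beta>) (edges_over h {i, j}) < \<infinity>"
proof -
  have "emeasure (lrp_edge_measure \<beta>) (edges_over h {i, j}) = far_mean \<beta> h r i j"
    using assms by (simp add: far_mean_def)
  also have "\<dots> = (\<integral>\<^sup>+j'. far_mean \<beta> h r i j' * indicator {j} j' \<partial>count_space UNIV)"
    by simp
  also have "\<dots> \<le> (\<integral>\<^sup>+j'. far_mean \<beta> h r i j' \<partial>count_space UNIV)"
    by (intro nn_integral_mono) (auto split: split_indicator)
  also have "\<dots> \<le> ennreal (h ^ CARD('n) * (\<beta> * tail_const TYPE('n) / r ^ CARD('n)))"
    using beta_pos assms(2,3) by (rule nn_integral_far_mean_le)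
  also have "\<dots> < \<infinity>"
    by simp
  finally show ?thesis .
qed

text \<open>Distinct pairs of cells are independent, and a pair that occurs \<open>k\<close> times contributes at most the
\<open>k\<close>-th power of its mean. The resulting bound is the same product as if all pairs were distinct.\<close>

lemma emeasure_occupied_le:
  assumes "far_path h r es" "h > 0" "r > 0"
  shows "emeasure M (occupied h es) \<le> prod_list (map (\<lambda>(i, j). far_mean \<beta> h r i j) es)"
    and "occupied h es \<in> events"
proof -
  let ?\<mu> = "lrp_edge_measure \<beta> :: (real ^ 'n) set measure"
  let ?k = "count_list (map undirected es)"
  have S: "edges_over h e \<in> sets ?\<mu> \<and> emeasure ?\<mu> (edges_over h e) < \<infinity>" if "e \<in> undirected ` set es" for e
    using that assms emeasure_edges_over_far edges_over_sets by (fastforce simp: far_path_def)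
  have "occupied h es = (if es = [] then space M else (\<Inter>e\<in>undirected ` set es. at_least (edges_over h e) (?k e)))"
    by (auto simp: occupied_def at_least_def neq_Nil_conv)
  also have "\<dots> \<in> events"
  proof (cases "es = []")
    case False
    then show ?thesis
      using S by (simp only: if_False) (intro sets.finite_INT at_least_event, auto)
  qed simp
  finally show "occupied h es \<in> events" .
  have "emeasure M (occupied h es) = ennreal (\<Prod>e\<in>undirected ` set es. prob (at_least (edges_over h e) (?k e)))"
    unfolding occupied_def emeasure_eq_measure
    using S by (subst prob_all_at_least) (auto intro: disjoint_edges_over)
  also have "\<dots> \<le> ennreal (\<Prod>e\<in>undirected ` set es. measure ?\<mu> (edges_over h e) ^ ?k e)"
    using S by (intro ennreal_leI prod_mono conjI prob_at_least_le) auto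
  also have "\<dots> = (\<Prod>e\<in>undirected ` set es. emeasure ?\<mu> (edges_over h e) ^ ?k e)"
    using S by (subst prod_ennreal[symmetric])
      (auto intro!: prod.cong simp: emeasure_eq_ennreal_measure ennreal_power less_top)
  also have "\<dots> = prod_list (map (\<lambda>e. emeasure ?\<mu> (edges_over h e)) (map undirected es))"
    by (rule prod_power_count_list) auto
  also have "\<dots> = prod_list (map (\<lambda>(i, j). far_mean \<beta> h r i j) es)"
    using assms(1) by (intro arg_cong[where f=prod_list])
      (auto simp: far_path_def far_mean_def)
  finally show "emeasure M (occupied h es) \<le> prod_list (map (\<lambda>(i, j). far_mean \<beta> h r i j) es)" .
qed

definition short_paths :: "real \<Rightarrow> real \<Rightarrow> nat \<Rightarrow> ((int ^ 'n) \<times> (int ^ 'n)) list set" where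
  "short_paths h r m = {es. length es = m \<and> far_path h r es \<and> jump_length 0 es \<le> 2 * CARD('n) * m}"

text \<open>The union bound over all paths. A walking length of at most \<open>2 d m\<close> costs the factor
\<open>4 ^ (2 d m + d m) = 64 ^ (d m)\<close>.\<close>

lemma emeasure_short_paths_le:
  assumes "h > 0" "r > 0"
  shows "emeasure M (\<Union>es\<in>short_paths h r m. occupied h es)
    \<le> ennreal (64 ^ CARD('n) * (h ^ CARD('n) * (\<beta> * tail_const TYPE('n) / r ^ CARD('n)))) ^ m"
proof -
  let ?q = "h ^ CARD('n) * (\<beta> * tail_const TYPE('n) / r ^ CARD('n))"
  let ?p = "far_mean \<beta> h r :: int ^ 'n \<Rightarrow> _"
  have "emeasure M (\<Union>es\<in>short_paths h r m. occupied h es)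
      \<le> (\<integral>\<^sup>+es. emeasure M (occupied h es) \<partial>count_space (short_paths h r m))"
    using assms by (intro emeasure_UN_le_nn_integral)
      (auto simp: short_paths_def intro: emeasure_occupied_le(2))
  also have "\<dots> = (\<integral>\<^sup>+es. emeasure M (occupied h es) * indicator (short_paths h r m) es \<partial>count_space UNIV)"
    by (subst nn_integral_count_space_indicator) auto
  also have "\<dots> \<le> (\<integral>\<^sup>+es. ennreal (64 ^ (CARD('n) * m)) *
      (path_weight ?p 0 es * indicator {es. length es = m} es) \<partial>count_space UNIV)"
  proof (intro nn_integral_mono)
    fix es :: "((int ^ 'n) \<times> (int ^ 'n)) list"
    show "emeasure M (occupied h es) * indicator (short_paths h r m) es
        \<le> ennreal (64 ^ (CARD('n) * m)) * (path_weight ?p 0 es * indicator {es. length es = m} es)"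
    proof (cases "es \<in> short_paths h r m")
      case True
      then have es: "length es = m" "far_path h r es" "jump_length 0 es \<le> 2 * CARD('n) * m"
        by (auto simp: short_paths_def)
      have "emeasure M (occupied h es) \<le> prod_list (map (\<lambda>(i, j). ?p i j) es)"
        using es(2) assms by (rule emeasure_occupied_le)
      also have "\<dots> \<le> ennreal (4 ^ (jump_length 0 es + CARD('n) * length es)) * path_weight ?p 0 es"
        by (rule prod_list_le_path_weight)
      also have "\<dots> \<le> ennreal (64 ^ (CARD('n) * m)) * path_weight ?p 0 es"
      proof (intro mult_right_mono ennreal_leI)
        have "(4 :: real) ^ (jump_length 0 es + CARD('n) * length es) \<le> 4 ^ (3 * (CARD('n) * m))"
          using es by (intro power_increasing) (simp_all add: algebra_simps)
        also have "\<dots> = 64 ^ (CARD('n) * m)"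
          by (subst power_mult) simp
        finally show "(4 :: real) ^ (jump_length 0 es + CARD('n) * length es) \<le> 64 ^ (CARD('n) * m)" .
      qed simp
      finally show ?thesis
        using True es(1) by simp
    qed simp
  qed
  also have "\<dots> = ennreal (64 ^ (CARD('n) * m)) *
      (\<integral>\<^sup>+es. path_weight ?p 0 es * indicator {es. length es = m} es \<partial>count_space UNIV)"
    by (rule nn_integral_cmult) simp
  also have "\<dots> \<le> ennreal (64 ^ (CARD('n) * m)) * ennreal ?q ^ m"
    using beta_pos assms by (intro mult_left_mono sum_path_weight_le nn_integral_far_mean_le) auto
  also have "\<dots> = ennreal (64 ^ CARD('n) * ?q) ^ m"
  proof -
    have "?q \<ge> 0"
      using assms beta_pos by (simp add: tail_const_def)
    then have "ennreal (64 ^ CARD('n) * ?q) = ennreal (64 ^ CARD('n)) * ennreal ?q"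
      by (intro ennreal_mult) auto
    moreover have "ennreal (64 ^ (CARD('n) * m)) = ennreal (64 ^ CARD('n)) ^ m"
      by (simp only: power_mult) (rule ennreal_power[symmetric], simp)
    ultimately show ?thesis
      by (simp only: power_mult_distrib)
  qed
  finally show ?thesis .
qed

lemma path_occupies_cells:
  assumes "\<omega> \<in> space M" "admissible \<delta> (\<E> \<omega>) es" "distinct (map undirected es)"
  shows "\<omega> \<in> occupied h (map (map_prod (cell h) (cell h)) es)"
proof -
  let ?c = "map_prod (cell h) (cell h) :: _ \<Rightarrow> (int ^ 'n) \<times> (int ^ 'n)"
  have und: "undirected (?c p) = cell h ` undirected p" for p
    by (cases p) auto
  have "count_list (map undirected (map ?c es)) e \<le> card (\<E> \<omega> \<inter> edges_over h e)"
    if fin: "finite (\<E> \<omega> \<inter> edges_over h e)" for e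
  proof -
    let ?fs = "filter (\<lambda>p. e = undirected (?c p)) es"
    have "count_list (map undirected (map ?c es)) e = length ?fs"
      by (simp add: count_list_eq_length_filter filter_map o_def)
    also have "\<dots> = card (set (map undirected ?fs))"
      using distinct_map_filter[OF assms(3)] by (subst distinct_card) auto
    also have "\<dots> \<le> card (\<E> \<omega> \<inter> edges_over h e)"
    proof (rule card_mono[OF fin])
      show "set (map undirected ?fs) \<subseteq> \<E> \<omega> \<inter> edges_over h e"
        using assms(2) by (auto simp: admissible_def doubleton_in_edges_over)
    qed
    finally show ?thesis .
  qed
  then show ?thesis
    using assms(1) by (auto simp: occupied_def at_least_def not_less)
qed

lemma jump_length_cells_le:
  fixes x y :: "real ^ 'n"
  assumes "h > 0"
  shows "real (jump_length (cell h x) (map (map_prod (cell h) (cell h)) es))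
    \<le> real CARD('n) * (path_cost x es y / h + real (length es))"
proof (induction x es y rule: path_cost.induct)
  case (1 x y)
  then show ?case
    using assms by simp
next
  case (2 x u v es y)
  have "real (nat (norm1 (cell h u - cell h x))) \<le> real CARD('n) * (norm (x - u) / h + 1)"
    using norm1_cell_diff_le[OF assms, of x u] norm1_nonneg[of "cell h x - cell h u"]
    by (simp add: norm1_minus_commute)
  then show ?case
    using 2 by (simp add: algebra_simps add_divide_distrib)
qed

lemma far_cells:
  fixes u v :: "real ^ 'n"
  assumes "norm (u - v) > \<delta>" "h > 0" "2 * real CARD('n) * h \<le> \<delta> / 2"
  shows "far h (\<delta> / 2) (cell h u) (cell h v)"
  unfolding far_def
proof (intro ballI)
  fix x y assume "x \<in> cube h (cell h u)" "y \<in> cube h (cell h v)"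
  then have "norm (u - x) \<le> real CARD('n) * h" "norm (y - v) \<le> real CARD('n) * h"
    using norm_same_cell_le[OF assms(2), of u x] norm_same_cell_le[OF assms(2), of y v] by simp_all
  moreover have "norm (u - v) \<le> norm (u - x) + norm (x - y) + norm (y - v)"
    using norm_triangle_ineq[of "u - x" "x - y"] norm_triangle_ineq[of "u - y" "y - v"] by simp
  ultimately show "norm (x - y) \<ge> \<delta> / 2"
    using assms by linarith
qed

end

text \<open>The mesh is a fraction \<open>s\<close> of \<open>\<delta>\<close>. A path with \<open>m\<close> edges and
cost at most \<open>s \<delta> m\<close> makes walks of at most \<open>m\<close> mesh widths in all, and
rounding to cells adds one more per walk and coordinate; this accounts for the walking length
\<open>2 d m\<close> in \<^const>\<open>poisson_lrp.short_paths\<close>. Edges of scope greater than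
\<open>\<delta>\<close> join cells at distance at least \<open>\<delta> / 2\<close> when
\<open>s \<le> 1 / (4 d)\<close>, and the mean number of such edges per cell is of order \<open>s ^ d\<close>.
For small \<open>s\<close> the probability that such a path exists is at most \<open>(1 / 8) ^ m\<close>,
which sums to \<open>1 / 7\<close> over \<open>m \<ge> 1\<close>.\<close>

lemma edges_cost_length:
  fixes \<E> :: "'v \<Rightarrow> (real ^ 'n) set set"
  assumes "continuous_lrp M \<beta> \<E>" "\<beta> > 0"
  obtains s where "0 < s" "s \<le> 1"
    and "\<And>\<delta>. \<delta> > 0 \<Longrightarrow> \<exists>B\<in>sets M. measure M B \<le> 1 / 7 \<and>
      (\<forall>\<omega>\<in>space M - B. \<forall>es y. es \<noteq> [] \<longrightarrow> admissible \<delta> (\<E> \<omega>) es \<longrightarrow> distinct (map undirected es) \<longrightarrow>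
        s * \<delta> * real (length es) < path_cost 0 es y)"
proof -
  interpret poisson_lrp M \<beta> \<E>
    using assms by (simp add: poisson_lrp_def poisson_lrp_axioms_def continuous_lrp_def)
  let ?d = "CARD('n)" and ?C = "\<beta> * tail_const TYPE('n)"
  \<comment> \<open>The first bound keeps the cells small compared with the scope of the edges.  The second makes
    the union bound geometric with ratio \<open>1 / 8\<close>: there \<open>128 = 64 * 2\<close>, the factor 2 coming from the
    minimal distance \<open>\<delta> / 2\<close> between cells, and \<open>s ^ d \<le> s\<close>.\<close>
  define s where "s = min (1 / (4 * real ?d)) (1 / (8 * 128 ^ ?d * ?C))"
  have C: "?C > 0"
    using assms(2) by (simp add: tail_const_def)
  have s: "0 < s" "s \<le> 1 / (4 * real ?d)" "s \<le> 1 / (8 * 128 ^ ?d * ?C)"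
    using C by (simp_all add: s_def)
  have "1 / (4 * real ?d) \<le> 1"
  proof -
    have "?d \<ge> 1"
      by (simp add: Suc_leI)
    then show ?thesis
      by (simp add: divide_le_eq del: One_nat_def)
  qed
  then have s1: "s \<le> 1"
    using s(2) by linarith
  have s2: "2 * real ?d * s \<le> 1 / 2"
    using s(2) by (simp add: field_simps)
  show thesis
  proof (rule that[OF s(1) s1])
    fix \<delta> :: real assume \<delta>: "\<delta> > 0"
    define h where "h = s * \<delta>"
    have h: "h > 0" "2 * real ?d * h \<le> \<delta> / 2"
      using s(1) s2 \<delta> mult_right_mono[OF s2, of \<delta>] by (simp_all add: h_def)
    define A where "A m = (\<Union>es\<in>short_paths h (\<delta> / 2) (Suc m). occupied h es)" for m
    have A: "A m \<in> events" for m
      unfolding A_def using h \<delta>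
      by (intro sets.countable_UN') (auto simp: short_paths_def intro: emeasure_occupied_le(2))
    have q: "64 ^ ?d * (h ^ ?d * (?C / (\<delta> / 2) ^ ?d)) \<le> 1 / 8"
    proof -
      have "64 ^ ?d * (h ^ ?d * (?C / (\<delta> / 2) ^ ?d)) = 128 ^ ?d * ?C * s ^ ?d"
      proof -
        have "(128 :: real) ^ ?d = 64 ^ ?d * 2 ^ ?d"
          by (simp flip: power_mult_distrib)
        moreover have "\<delta> ^ ?d \<noteq> 0"
          using \<delta> by simp
        ultimately show ?thesis
          by (simp add: h_def power_mult_distrib power_divide)
      qed
      also have "\<dots> \<le> 128 ^ ?d * ?C * s"
        using C s(1) s1 power_decreasing[of 1 ?d s] by (intro mult_left_mono) (auto simp: Suc_leI)
      also have "\<dots> \<le> 128 ^ ?d * ?C * (1 / (8 * 128 ^ ?d * ?C))"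
        using C s(3) by (intro mult_left_mono) auto
      also have "\<dots> = 1 / 8"
      proof -
        have "\<beta> \<noteq> 0" "tail_const TYPE('n) \<noteq> 0"
          using C by auto
        then show ?thesis
          by simp
      qed
      finally show ?thesis .
    qed
    have "emeasure M (A m) \<le> ennreal ((1 / 8) ^ Suc m)" for m
    proof -
      have "emeasure M (A m) \<le> ennreal (64 ^ ?d * (h ^ ?d * (?C / (\<delta> / 2) ^ ?d))) ^ Suc m"
        unfolding A_def using h \<delta> by (intro emeasure_short_paths_le) auto
      also have "\<dots> \<le> ennreal (1 / 8) ^ Suc m"
        by (intro power_mono ennreal_leI q) simp
      finally show ?thesis
        by (simp add: ennreal_power del: power_Suc)
    qed
    then have "emeasure M (\<Union>m. A m) \<le> (\<Sum>m. ennreal ((1 / 8) ^ Suc m))"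
      using A by (intro order.trans[OF emeasure_subadditive_countably] suminf_le summableI) auto
    also have "\<dots> = ennreal (1 / 7)"
      using sums_mult[OF geometric_sums[of "1 / 8 :: real"], of "1 / 8"]
      by (intro suminf_ennreal_eq) auto
    finally have B: "measure M (\<Union>m. A m) \<le> 1 / 7"
      by (simp add: emeasure_eq_measure)
    show "\<exists>B\<in>sets M. measure M B \<le> 1 / 7 \<and>
      (\<forall>\<omega>\<in>space M - B. \<forall>es y. es \<noteq> [] \<longrightarrow> admissible \<delta> (\<E> \<omega>) es \<longrightarrow> distinct (map undirected es) \<longrightarrow>
        s * \<delta> * real (length es) < path_cost 0 es y)"
    proof (intro bexI conjI ballI allI impI)
      show "measure M (\<Union>m. A m) \<le> 1 / 7"
        by (rule B)
      show "(\<Union>m. A m) \<in> events"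
        using A by auto
      fix \<omega> es and y :: "real ^ 'n"
      assume \<omega>: "\<omega> \<in> space M - (\<Union>m. A m)" and es: "es \<noteq> []" "admissible \<delta> (\<E> \<omega>) es" "distinct (map undirected es)"
      show "s * \<delta> * real (length es) < path_cost 0 es y"
      proof (rule ccontr)
        let ?cs = "map (map_prod (cell h) (cell h)) es :: ((int ^ 'n) \<times> (int ^ 'n)) list"
        assume "\<not> s * \<delta> * real (length es) < path_cost 0 es y"
        then have "path_cost 0 es y / h \<le> real (length es)"
          using h(1) by (simp add: h_def field_simps)
        then have "real ?d * (path_cost 0 es y / h + real (length es)) \<le> real ?d * (2 * real (length es))"
          by (intro mult_left_mono) auto
        moreover have "cell h 0 = (0 :: int ^ 'n)"
          by (simp add: cell_def vec_eq_iff)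
        moreover have "real ?d * (2 * real (length es)) = real (2 * ?d * length es)"
          by simp
        ultimately have "real (jump_length 0 ?cs) \<le> real (2 * ?d * length es)"
          using jump_length_cells_le[OF h(1), of 0 es y] by (simp only:)
        then have "jump_length 0 ?cs \<le> 2 * ?d * length es"
          by (simp only: of_nat_le_iff)
        moreover have "far_path h (\<delta> / 2) ?cs"
          using es(2) far_cells[OF _ h] by (fastforce simp: far_path_def admissible_def)
        moreover obtain m where "length es = Suc m"
          using es(1) by (cases es) auto
        ultimately have "?cs \<in> short_paths h (\<delta> / 2) (Suc m)"
          by (simp add: short_paths_def)
        then have "\<omega> \<in> A m"
          using path_occupies_cells[of \<omega> \<delta> es h] \<omega> es unfolding A_def by blast
        then show False
          using \<omega> by blast
      qed
    qed
  qed
qed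

section \<open>Comparison of the medians\<close>

lemma (in prob_space) ex_in_Int:
  assumes "A \<in> events" "B \<in> events" "prob A + prob B > 1"
  shows "A \<inter> B \<noteq> {}"
proof
  assume "A \<inter> B = {}"
  then have "prob (A \<union> B) = prob A + prob B"
    using assms by (intro finite_measure_Union) auto
  then show False
    using assms(3) prob_le_1[of "A \<union> B"] by simp
qed

lemma is_median_events:
  assumes "is_median M X m"
  shows "{\<omega> \<in> space M. X \<omega> \<le> m} \<in> sets M" "{\<omega> \<in> space M. X \<omega> \<ge> m} \<in> sets M"
  using assms measure_notin_sets[of _ M] unfolding is_median_def by fastforce+

text \<open>An event of probability at least \<open>3 / 4\<close> meets both events in the definition of a median.\<close>

lemma median_between:
  assumes "prob_space M" "is_median M X m" "Y \<in> sets M" "measure M Y \<ge> 3 / 4"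
    and Y: "\<And>\<omega>. \<omega> \<in> Y \<Longrightarrow> lo \<le> X \<omega> \<and> X \<omega> \<le> hi"
  shows "lo \<le> m \<and> m \<le> hi"
proof -
  interpret prob_space M by fact
  have "{\<omega> \<in> space M. X \<omega> \<le> m} \<inter> Y \<noteq> {}" "{\<omega> \<in> space M. X \<omega> \<ge> m} \<inter> Y \<noteq> {}"
    using assms is_median_events[OF assms(2)] unfolding is_median_def by (intro ex_in_Int; simp)+
  then show ?thesis
    using Y by fastforce
qed

definition typical :: "real \<Rightarrow> real \<Rightarrow> real \<Rightarrow> nat \<Rightarrow> nat \<Rightarrow> bool" where
  "typical c C \<theta> n m \<longleftrightarrow> c * real n powr \<theta> \<le> real m \<and> real m \<le> C * real n powr \<theta>"

lemma lattice_point_diagonal: "lattice_point (int n *s 1 :: int ^ 'n) = real n *\<^sub>R (1 :: real ^ 'n)"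
  by (simp add: lattice_point_def vec_eq_iff)

lemma distance_exponent_diagonal:
  fixes G :: "'w \<Rightarrow> (int ^ 'n) set set"
  assumes "distance_exponent M G \<theta>"
  obtains c C where "c > 0" "C > 0"
    "\<And>n. measure M {\<omega> \<in> space M. typical c C \<theta> n (graph_dist (G \<omega>) 0 (int n *s 1))} \<ge> 3 / 4"
proof -
  let ?N = "norm (1 :: real ^ 'n)"
  have N: "?N > 0"
    by simp
  have "(0 :: real) < 1 / 4"
    by simp
  with assms obtain c C where "c > 0" "C > 0" and
    *: "\<And>u. measure M {\<omega> \<in> space M.
        c * norm (lattice_point u) powr \<theta> \<le> real (graph_dist (G \<omega>) 0 u) \<and>
        real (graph_dist (G \<omega>) 0 u) \<le> C * norm (lattice_point u) powr \<theta>} \<ge> 1 - 1 / 4"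
    unfolding distance_exponent_def by blast
  have norm: "norm (lattice_point (int n *s 1 :: int ^ 'n)) powr \<theta> = ?N powr \<theta> * real n powr \<theta>" for n
    by (simp add: lattice_point_diagonal powr_mult mult.commute)
  show thesis
  proof (rule that[of "c * ?N powr \<theta>" "C * ?N powr \<theta>"])
    show "measure M {\<omega> \<in> space M. typical (c * ?N powr \<theta>) (C * ?N powr \<theta>) \<theta> n (graph_dist (G \<omega>) 0 (int n *s 1))} \<ge> 3 / 4" for n
      using *[of "int n *s 1"] unfolding typical_def norm by (simp add: mult.assoc)
  qed (use \<open>c > 0\<close> \<open>C > 0\<close> N in auto)
qed

lemma powr_bounds_imp_bounded:
  fixes a :: "nat \<Rightarrow> real"
  assumes "c > 0" and a: "\<And>n. n \<ge> 1 \<Longrightarrow> c * real n powr p \<le> a n \<and> a n \<le> C * real n powr p"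
  shows "\<forall>n\<ge>1. a n \<noteq> 0"
    and "bounded ((\<lambda>n. real n powr (- p) * a n) ` {1..})"
    and "bounded ((\<lambda>n. real n powr p * inverse (a n)) ` {1..})"
proof -
  have pos: "a n > 0" if "n \<ge> 1" for n
  proof -
    have "0 < c * real n powr p"
      using assms(1) that by simp
    then show ?thesis
      using a[OF that] by linarith
  qed
  then show "\<forall>n\<ge>1. a n \<noteq> 0"
    by (metis less_irrefl)
  have "norm (real n powr (- p) * a n) \<le> C" if "n \<ge> 1" for n
  proof -
    have "real n powr (- p) * a n \<le> real n powr (- p) * (C * real n powr p)"
      using a[OF that] by (intro mult_left_mono) auto
    also have "\<dots> = C"
      using that by (simp add: powr_minus)
    finally show ?thesis
      using pos[OF that] by simp
  qed
  then show "bounded ((\<lambda>n. real n powr (- p) * a n) ` {1..})"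
    by (auto simp: bounded_iff)
  have "norm (real n powr p * inverse (a n)) \<le> 1 / c" if "n \<ge> 1" for n
    using a[OF that] pos[OF that] assms(1) by (simp add: field_simps)
  then show "bounded ((\<lambda>n. real n powr p * inverse (a n)) ` {1..})"
    by (auto simp: bounded_iff)
qed

lemma lrp_dist_typical_upper:
  fixes E :: "(real ^ 'n) set set"
  assumes "\<beta> > 0" "n \<ge> 1" "typical c C \<theta> n (graph_dist (coarse_graph \<beta> (1 / real n) E) 0 (int n *s 1))"
  shows "lrp_dist (1 / real n) E 0 1 \<le> real CARD('n) * C * real n powr (\<theta> - 1)"
proof -
  let ?h = "1 / real n" and ?D = "graph_dist (coarse_graph \<beta> (1 / real n) E) 0 (int n *s 1)"
  have ends: "?h *\<^sub>R lattice_point 0 = (0 :: real ^ 'n)" "?h *\<^sub>R lattice_point (int n *s 1) = (1 :: real ^ 'n)"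
    using assms(2) by (simp_all add: lattice_point_diagonal) (simp add: lattice_point_def vec_eq_iff)
  have "lrp_dist ?h E 0 1 \<le> real CARD('n) * ?h * real ?D"
    using lrp_dist_le_graph_dist[OF assms(1), of ?h E 0 "int n *s 1"] assms(2) unfolding ends by simp
  also have "\<dots> \<le> real CARD('n) * ?h * (C * real n powr \<theta>)"
    using assms(3) by (intro mult_left_mono) (auto simp: typical_def)
  also have "\<dots> = real CARD('n) * C * real n powr (\<theta> - 1)"
    using assms(2) by (simp add: powr_diff)
  finally show ?thesis .
qed

text \<open>With \<open>x\<close> the cost divided by the mesh, the hypothesis \<open>few\<close> bounds the number of
edges by \<open>x / s\<close>. It also shows \<open>1 \<le> x / s\<close>, since \<open>s \<le> 1\<close> and
a path without edges costs at least 1. So the additive terms in the comparison with the graph distance are all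
absorbed by a multiple of \<open>x\<close>, for every \<open>n\<close> and not only for large ones.\<close>

lemma path_cost_typical_lower:
  fixes E :: "(real ^ 'n) set set"
  assumes "n \<ge> 1" "0 < s" "s \<le> 1"
    and is_typ: "typical c C \<theta> n (graph_dist (coarse_graph \<beta> (1 / real n) E) 0 (int n *s 1))"
    and es: "admissible (1 / real n) E es"
    and few: "es \<noteq> [] \<Longrightarrow> s * (1 / real n) * real (length es) < path_cost 0 es 1"
  shows "path_cost 0 es 1 \<ge> c / (real CARD('n) + (2 * real CARD('n) + 1) / s) * real n powr (\<theta> - 1)"
proof -
  let ?d = "real CARD('n)" and ?L = "path_cost 0 es (1 :: real ^ 'n)"
  let ?x = "real n * ?L"
  have "s * real (length es) \<le> ?x \<and> s \<le> ?x"
  proof (cases "es = []")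
    case True
    have "norm (1 :: real ^ 'n) \<ge> 1"
      using component_le_norm_cart[of "1 :: real ^ 'n" undefined] by simp
    then have "1 * 1 \<le> real n * norm (1 :: real ^ 'n)"
      using assms(1) by (intro mult_mono) auto
    then show ?thesis
      using True assms(2,3) by simp
  next
    case False
    then have "s * real (length es) < ?x"
      using few assms(1) by (simp add: field_simps)
    moreover have "s * 1 \<le> s * real (length es)"
      using False assms(2) by (intro mult_left_mono) (auto simp: Suc_le_eq)
    ultimately show ?thesis by simp
  qed
  then have len: "real (length es) \<le> ?x / s" and one: "1 \<le> ?x / s"
    using assms(2) by (simp_all add: field_simps)
  have ends: "cell (1 / real n) (0 :: real ^ 'n) = 0" "cell (1 / real n) (1 :: real ^ 'n) = int n *s 1"
    using cell_centre[of "1 / real n" "int n *s 1 :: int ^ 'n"] assms(1)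
    by (simp_all add: lattice_point_diagonal) (simp add: cell_def vec_eq_iff)
  obtain m where m: "(0, int n *s 1) \<in> adj (coarse_graph \<beta> (1 / real n) E) ^^ m"
    "real m \<le> ?d * ?x + ?d * (real (length es) + 1) + real (length es)"
    using graph_walk_of_continuous_path[OF es, where x=0 and y=1 and \<beta>=\<beta>] assms(1)
    unfolding ends by (auto simp: mult.commute)
  have "c * real n powr \<theta> \<le> real (graph_dist (coarse_graph \<beta> (1 / real n) E) 0 (int n *s 1))"
    using is_typ by (simp add: typical_def)
  also have "\<dots> \<le> real m"
    using graph_dist_le[OF m(1)] by simp
  also have "\<dots> \<le> ?d * ?x + ?d * (?x / s + ?x / s) + ?x / s"
  proof -
    have "?d * (real (length es) + 1) \<le> ?d * (?x / s + ?x / s)"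
      using len one by (intro mult_left_mono add_mono) simp_all
    then show ?thesis
      using m(2) len by linarith
  qed
  also have "\<dots> = (?d + (2 * ?d + 1) / s) * ?x"
    using assms(2) by (simp add: field_simps)
  finally have "c * real n powr \<theta> \<le> (?d + (2 * ?d + 1) / s) * (real n * ?L)" .
  moreover have "?d + (2 * ?d + 1) / s > 0"
    using assms(2) by (intro add_nonneg_pos divide_pos_pos) auto
  moreover have "real n powr (\<theta> - 1) = real n powr \<theta> / real n"
    using assms(1) by (simp add: powr_diff)
  ultimately show ?thesis
    using assms(1) by (simp add: divide_le_eq pos_divide_le_eq mult.commute mult.left_commute)
qed

theorem lemma1p6:
  fixes \<beta> \<theta> :: real
    and M :: "'w measure" and G :: "'w \<Rightarrow> (int ^ 'n) set set"
    and M' :: "'v measure" and \<E> :: "'v \<Rightarrow> (real ^ 'n) set set"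
    and a a_hat :: "nat \<Rightarrow> real"
  assumes "\<beta> > 0"
    and "discrete_lrp M \<beta> G"
    and "distance_exponent M G \<theta>"
    and "continuous_lrp M' \<beta> \<E>"
    and "\<And>n. n \<ge> 1 \<Longrightarrow> is_median M (\<lambda>\<omega>. real (graph_dist (G \<omega>) 0 (int n *s 1))) (a_hat n)"
    and "\<And>n. n \<ge> 1 \<Longrightarrow> is_median M' (\<lambda>\<omega>. lrp_dist (1 / real n) (\<E> \<omega>) 0 1) (a n)"
  shows "(\<forall>n\<ge>1. a n \<noteq> 0 \<and> a_hat n \<noteq> 0) \<and>
    bounded ((\<lambda>n. real n powr (1 - \<theta>) * a n) ` {1..}) \<and>
    bounded ((\<lambda>n. real n powr (\<theta> - 1) * inverse (a n)) ` {1..}) \<and>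
    bounded ((\<lambda>n. real n powr (- \<theta>) * a_hat n) ` {1..}) \<and>
    bounded ((\<lambda>n. real n powr \<theta> * inverse (a_hat n)) ` {1..})"
proof -
  interpret M: prob_space M
    using assms(2) by (simp add: discrete_lrp_def)
  interpret M': prob_space M'
    using assms(4) by (simp add: continuous_lrp_def poisson_point_process_def)
  obtain c C where c: "c > 0" "C > 0" and is_typ:
    "\<And>n. measure M {\<omega> \<in> space M. typical c C \<theta> n (graph_dist (G \<omega>) 0 (int n *s 1))} \<ge> 3 / 4"
    using distance_exponent_diagonal[OF assms(3)] by blast
  have a_hat: "c * real n powr \<theta> \<le> a_hat n \<and> a_hat n \<le> C * real n powr \<theta>" if "n \<ge> 1" for n
    using measure_graph_dist_eq(2)[OF assms(2) assms(2)]
    by (intro median_between[OF M.prob_space_axioms assms(5)[OF that] _ is_typ[of n]])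
      (auto simp: typical_def)
  obtain s where s: "0 < s" "s \<le> 1" and cheap:
    "\<And>\<delta>. \<delta> > 0 \<Longrightarrow> \<exists>B\<in>sets M'. measure M' B \<le> 1 / 7 \<and>
      (\<forall>\<omega>\<in>space M' - B. \<forall>es y. es \<noteq> [] \<longrightarrow> admissible \<delta> (\<E> \<omega>) es \<longrightarrow> distinct (map undirected es) \<longrightarrow>
        s * \<delta> * real (length es) < path_cost 0 es y)"
    using edges_cost_length[OF assms(4,1)] by metis
  define c' where "c' = c / (real CARD('n) + (2 * real CARD('n) + 1) / s)"
  have c': "c' > 0"
    unfolding c'_def using c s by (intro divide_pos_pos add_nonneg_pos) auto
  have a: "c' * real n powr (\<theta> - 1) \<le> a n \<and> a n \<le> real CARD('n) * C * real n powr (\<theta> - 1)" if n: "n \<ge> 1" for n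
  proof
    let ?D = "\<lambda>\<omega>. graph_dist (coarse_graph \<beta> (1 / real n) (\<E> \<omega>)) 0 (int n *s 1)"
    let ?T = "{\<omega> \<in> space M'. typical c C \<theta> n (?D \<omega>)}"
    have coarse: "discrete_lrp M' \<beta> (\<lambda>\<omega>. coarse_graph \<beta> (1 / real n) (\<E> \<omega>))"
      using n by (intro discrete_lrp_coarse_graph[OF assms(4,1)]) simp
    have T: "?T \<in> sets M'" "measure M' ?T \<ge> 3 / 4"
      using measure_graph_dist_eq(2)[OF coarse coarse, of "typical c C \<theta> n"]
        measure_graph_dist_eq(1)[OF assms(2) coarse, of "typical c C \<theta> n"] is_typ[of n] by auto
    note med = assms(6)[OF n, unfolded is_median_def] is_median_events[OF assms(6)[OF n]]
    have "{\<omega> \<in> space M'. a n \<le> lrp_dist (1 / real n) (\<E> \<omega>) 0 1} \<inter> ?T \<noteq> {}"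
      using med T by (intro M'.ex_in_Int) auto
    then show "a n \<le> real CARD('n) * C * real n powr (\<theta> - 1)"
      using lrp_dist_typical_upper[OF assms(1) n] by fastforce
    obtain B where B: "B \<in> sets M'" "measure M' B \<le> 1 / 7" and
      few: "\<And>\<omega> es y. \<omega> \<in> space M' - B \<Longrightarrow> es \<noteq> [] \<Longrightarrow> admissible (1 / real n) (\<E> \<omega>) es \<Longrightarrow>
        distinct (map undirected es) \<Longrightarrow> s * (1 / real n) * real (length es) < path_cost 0 es y"
      using cheap[of "1 / real n"] n by auto
    \<comment> \<open>The three probabilities satisfy \<open>1 / 2 + 3 / 4 - 1 / 7 > 1\<close>.\<close>
    have "measure M' (?T - B) \<ge> measure M' ?T - measure M' B"
      using M'.finite_measure_Diff'[OF T(1) B(1)] M'.finite_measure_mono[of "?T \<inter> B" B] B(1) by simp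
    then have "{\<omega> \<in> space M'. lrp_dist (1 / real n) (\<E> \<omega>) 0 1 \<le> a n} \<inter> (?T - B) \<noteq> {}"
      using med T B by (intro M'.ex_in_Int) auto
    then obtain \<omega> where \<omega>: "\<omega> \<in> space M' - B" "typical c C \<theta> n (?D \<omega>)"
      and le: "lrp_dist (1 / real n) (\<E> \<omega>) 0 1 \<le> a n"
      by blast
    show "c' * real n powr (\<theta> - 1) \<le> a n"
    proof (rule field_le_epsilon)
      fix \<epsilon> :: real assume "\<epsilon> > 0"
      then obtain fs where fs: "admissible (1 / real n) (\<E> \<omega>) fs" "path_cost 0 fs 1 < a n + \<epsilon>"
        using lrp_dist_approx[of "1 / real n" "\<E> \<omega>" 0 1 "a n + \<epsilon>"] le by auto
      obtain es where es: "admissible (1 / real n) (\<E> \<omega>) es" "path_cost 0 es 1 \<le> path_cost 0 fs (1 :: real ^ 'n)"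
        "distinct (map undirected es)"
        using distinct_edges[OF fs(1)] by blast
      have "c' * real n powr (\<theta> - 1) \<le> path_cost 0 es 1"
        unfolding c'_def using few[OF \<omega>(1)] es
        by (intro path_cost_typical_lower[OF n s \<omega>(2)]) auto
      then show "c' * real n powr (\<theta> - 1) \<le> a n + \<epsilon>"
        using es(2) fs(2) by linarith
    qed
  qed
  show ?thesis
    using powr_bounds_imp_bounded[OF c' a] powr_bounds_imp_bounded[OF c(1) a_hat] by simp
qed

end
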